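(* There is a one-to-one correspondence between $\mathrm{Dend}_\infty$-algebras whose underlying chain complex is concentrated only in degrees $0$ and $n-1$ with zero differential, i.e. of the form $$A_{n-1}\xrightarrow{0}0\xrightarrow{0}\cdots\xrightarrow{0}0\xrightarrow{0}A_0,$$ and tuples $(A,M,\theta_1,\theta_2,\sigma)$ where $A$ is a dendriform algebra, $(M,\theta_1,\theta_2)$ is a representation of $A$ and $\sigma:\mathbb{K}[C_{n+1}]\otimes A^{\otimes(n+1)}\to M$ is an $(n+1)$-cocycle of $A$ with coefficients in $M$.
   Context: $\mathbb{K}$ is a field of characteristic $0$. The integer $n$ in the claim satisfies $n\ge2$, so that the degrees $0$ and $n-1$ are distinct. $C_k=\{[1],\ldots,[k]\}$ is a set of $k$ symbols, $\mathbb{K}[C_k]$ the vector space with basis $C_k$. For $1\le \lambda\le j$, $i\ge 1$: $R_0^{j,i,\lambda}:C_{i+j-1}\to C_j$ sends $[r]$ to $[r]$ if $r\le\lambda-1$, to $[\lambda]$ if $\lambda\le r\le\lambda+i-1$, to $[r-i+1]$ if $r\ge\lambda+i$; $R^{j,i,\lambda}:C_{i+j-1}\to\mathbb{K}[C_i]$ sends $[r]$ to $[r-\lambda+1]$ if $\lambda\le r\le\lambda+i-1$ and to $[1]+\cdots+[i]$ otherwise. A $\mathrm{Dend}_\infty$-algebra is a graded vector space $A=\oplus A_i$ with multilinear maps $\mu_{k,[r]}:A^{\otimes k}\to A$ ($[r]\in C_k$, $1\le k<\infty$; the notation is extended linearly to labels in $\mathbb{K}[C_k]$) of degree $k-2$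 such that for all $N\ge1$, $[r]\in C_N$ and $a_1,\ldots,a_N\in A$ (homogeneous, with $|a|$ the degree of $a$), $$\sum_{i+j=N+1}\sum_{\lambda=1}^j(-1)^{\lambda(i+1)+i(|a_1|+\cdots+|a_{\lambda-1}|)}\mu_{j,R_0^{j,i,\lambda}[r]}\big(a_1,\ldots,a_{\lambda-1},\mu_{i,R^{j,i,\lambda}[r]}(a_\lambda,\ldots,a_{\lambda+i-1}),a_{\lambda+i},\ldots,a_N\big)=0.$$ Its underlying chain complex is $(A,\mu_{1,[1]})$. Dendriform algebra: a vector space $A$ with bilinear $\prec,\succ$ satisfying (D1) $(a\prec b)\prec c=a\prec(b\prec c+b\succ c)$, (D2) $(a\succ b)\prec c=a\succ(b\prec c)$, (D3) $(a\prec b+a\succ b)\succ c=a\succ(b\succ c)$; encoded by $\pi_A([1];a,b)=a\prec b$, $\pi_A([2];a,b)=a\succ b$. A representation of $A$ is a vector space $M$ with bilinear maps $\prec,\succ:A\otimes M\to M$ and $\prec,\succ:M\otimes A\to M$ such that (D1)-(D3) hold whenever exactly one of $a,b,c$ is in $M$ and the other two are in $A$; encoded by $\theta_1([1];a,m)=a\prec m$, $\theta_1([2];a,m)=a\succ m$, $\theta_2([1];m,a)=m\prec a$, $\theta_2([2];m,a)=m\succ a$. Cochains: $C^k_{\mathrm{dend}}(A,M)=\mathrm{Hom}_{\mathbb{K}}(\mathbb{K}[C_k]\otimes A^{\otimes k},M)$, $k\ge1$, with $$(\delta_{\mathrm{dend}}f)([r];a_1,\ldots,a_{k+1})=\theta_1\big(R_0^{2,k,2}[r];a_1,f(R^{2,k,2}[r];a_2,\ldots,a_{k+1})\big)$$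 $$+\sum_{i=1}^k(-1)^i f\big(R_0^{k,2,i}[r];a_1,\ldots,a_{i-1},\pi_A(R^{k,2,i}[r];a_i,a_{i+1}),a_{i+2},\ldots,a_{k+1}\big)$$ $$+(-1)^{k+1}\theta_2\big(R_0^{2,k,1}[r];f(R^{2,k,1}[r];a_1,\ldots,a_k),a_{k+1}\big);$$ a $k$-cocycle is $f\in C^k_{\mathrm{dend}}(A,M)$ with $\delta_{\mathrm{dend}}f=0$. *)

theory Defs
  imports Complex_Main "HOL-Library.FuncSet" "HOL-Library.Poly_Mapping"
begin

text \<open>
  The ground field is a type of class \<^class>\<open>field_char_0\<close>. Vector spaces are linear subspaces of an
  ambient vector space whose scalar multiplication is an explicit parameter. Maps out of such
  subspaces are \<^const>\<open>extensional\<close>, so that equality of HOL functions is equality of maps.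
\<close>

definition linear_on ::
  "('k::field \<Rightarrow> 'a::ab_group_add \<Rightarrow> 'a) \<Rightarrow> ('k \<Rightarrow> 'b::ab_group_add \<Rightarrow> 'b) \<Rightarrow> 'a set \<Rightarrow> ('a \<Rightarrow> 'b) \<Rightarrow> bool"
where
  "linear_on s1 s2 U f \<longleftrightarrow>
     (\<forall>x\<in>U. \<forall>y\<in>U. f (x + y) = f x + f y) \<and> (\<forall>c. \<forall>x\<in>U. f (s1 c x) = s2 c (f x))"

definition bilinear_maps ::
  "('k::field \<Rightarrow> 'v::ab_group_add \<Rightarrow> 'v) \<Rightarrow> 'v set \<Rightarrow> 'v set \<Rightarrow> 'v set \<Rightarrow> ('v \<Rightarrow> 'v \<Rightarrow> 'v) set"
where
  "bilinear_maps s U V W =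
     {f \<in> U \<rightarrow>\<^sub>E (V \<rightarrow>\<^sub>E W).
        (\<forall>x\<in>U. linear_on s s V (\<lambda>y. f x y)) \<and> (\<forall>y\<in>V. linear_on s s U (\<lambda>x. f x y))}"

definition tuples :: "nat \<Rightarrow> 'a set \<Rightarrow> 'a list set" where
  "tuples k U = {xs. length xs = k \<and> set xs \<subseteq> U}"

definition multilinear_maps ::
  "('k::field \<Rightarrow> 'a::ab_group_add \<Rightarrow> 'a) \<Rightarrow> ('k \<Rightarrow> 'b::ab_group_add \<Rightarrow> 'b) \<Rightarrow>
     nat \<Rightarrow> 'a set \<Rightarrow> 'b set \<Rightarrow> ('a list \<Rightarrow> 'b) set"
where
  "multilinear_maps s1 s2 k U W =
     {f \<in> tuples k U \<rightarrow>\<^sub>E W. \<forall>xs\<in>tuples k U. \<forall>p<k. linear_on s1 s2 U (\<lambda>x. f (xs[p := x]))}"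

text \<open>
  The symbol $[r]$ of $C_k$ is the number \<open>r\<close> in \<open>{1..k}\<close>, and a vector of $K[C_k]$ is its
  coefficient function, of which only the values on \<open>{1..k}\<close> matter.
\<close>

definition R0 :: "nat \<Rightarrow> nat \<Rightarrow> nat \<Rightarrow> nat \<Rightarrow> nat" where
  "R0 j i l r = (if r \<le> l - 1 then r else if r \<le> l + i - 1 then l else r - i + 1)"

definition R :: "nat \<Rightarrow> nat \<Rightarrow> nat \<Rightarrow> nat \<Rightarrow> nat \<Rightarrow> 'k::field" where
  "R j i l r =
     (if l \<le> r \<and> r \<le> l + i - 1 then (\<lambda>s. if s = r - l + 1 then 1 else 0) else (\<lambda>s. 1))"

text \<open>Linear extension to $K[C_k]$ of a family \<open>g\<close> indexed by $C_k$, evaluated at \<open>v\<close>.\<close>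

definition extend_label ::
  "('k::field \<Rightarrow> 'v::ab_group_add \<Rightarrow> 'v) \<Rightarrow> nat \<Rightarrow> (nat \<Rightarrow> 'k) \<Rightarrow> (nat \<Rightarrow> 'v) \<Rightarrow> 'v"
where
  "extend_label s k v g = (\<Sum>r=1..k. s (v r) (g r))"

text \<open>
  A graded vector space is a family \<open>A\<close> of subspaces of the ambient space, indexed by the integers.
  The components need not be independent in the ambient space: the sum is the external one, whose
  elements are the finitely supported families with \<open>i\<close>-th entry in \<open>A i\<close>.
\<close>

definition direct_sum :: "(int \<Rightarrow> 'v::ab_group_add set) \<Rightarrow> (int \<Rightarrow>\<^sub>0 'v) set" where
  "direct_sum A = {x. \<forall>i. Poly_Mapping.lookup x i \<in> A i}"

definition scale_sum ::
  "('k::field \<Rightarrow> 'v::ab_group_add \<Rightarrow> 'v) \<Rightarrow> 'k \<Rightarrow> (int \<Rightarrow>\<^sub>0 'v) \<Rightarrow> (int \<Rightarrow>\<^sub>0 'v)"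
where
  "scale_sum s c = Poly_Mapping.map (s c)"

definition homogeneous :: "(int \<Rightarrow> 'v::ab_group_add set) \<Rightarrow> int \<Rightarrow> (int \<Rightarrow>\<^sub>0 'v) set" where
  "homogeneous A d = Poly_Mapping.single d ` A d"

text \<open>\<open>ds\<close> lists the degrees of the entries of \<open>xs\<close>.\<close>

definition homogeneous_tuple ::
  "(int \<Rightarrow> 'v::ab_group_add set) \<Rightarrow> int list \<Rightarrow> (int \<Rightarrow>\<^sub>0 'v) list \<Rightarrow> bool"
where
  "homogeneous_tuple A ds xs \<longleftrightarrow> list_all2 (\<lambda>d x. x \<in> homogeneous A d) ds xs"

text \<open>
  The left-hand side of the defining identity for \<open>N = length xs\<close> and the label \<open>r\<close>.
  Lists count from 0, so $a_1,\ldots,a_{l-1}$ is \<open>take (l - 1) xs\<close>.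
\<close>

definition dend_inf_sum ::
  "('k::field \<Rightarrow> 'v::ab_group_add \<Rightarrow> 'v) \<Rightarrow>
     (nat \<Rightarrow> nat \<Rightarrow> (int \<Rightarrow>\<^sub>0 'v) list \<Rightarrow> (int \<Rightarrow>\<^sub>0 'v)) \<Rightarrow>
     nat \<Rightarrow> int list \<Rightarrow> (int \<Rightarrow>\<^sub>0 'v) list \<Rightarrow> (int \<Rightarrow>\<^sub>0 'v)"
where
  "dend_inf_sum s \<mu> r ds xs =
     (\<Sum>(i, j) \<in> {(i, j). 1 \<le> i \<and> 1 \<le> j \<and> i + j = length xs + 1}. \<Sum>l=1..j.
        scale_sum s ((- 1) powi (int l * (int i + 1) + int i * sum_list (take (l - 1) ds)))
          (\<mu> j (R0 j i l r)
             (take (l - 1) xs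
              @ [extend_label (scale_sum s) i (R j i l r)
                   (\<lambda>t. \<mu> i t (take i (drop (l - 1) xs)))]
              @ drop (l - 1 + i) xs)))"

definition dend_inf_algebra ::
  "('k::field \<Rightarrow> 'v::ab_group_add \<Rightarrow> 'v) \<Rightarrow> (int \<Rightarrow> 'v set) \<Rightarrow>
     (nat \<Rightarrow> nat \<Rightarrow> (int \<Rightarrow>\<^sub>0 'v) list \<Rightarrow> (int \<Rightarrow>\<^sub>0 'v)) \<Rightarrow> bool"
where
  "dend_inf_algebra s A \<mu> \<longleftrightarrow>
     (\<forall>i. module.subspace s (A i)) \<and>
     \<mu> \<in> (\<Pi>\<^sub>E k\<in>{1..}. \<Pi>\<^sub>E r\<in>{1..k}.
            multilinear_maps (scale_sum s) (scale_sum s) k (direct_sum A) (direct_sum A)) \<and>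
     (\<forall>k\<ge>1. \<forall>r\<in>{1..k}. \<forall>ds xs. length xs = k \<and> homogeneous_tuple A ds xs \<longrightarrow>
        \<mu> k r xs \<in> homogeneous A (sum_list ds + int k - 2)) \<and>
     (\<forall>N\<ge>1. \<forall>r\<in>{1..N}. \<forall>ds xs. length xs = N \<and> homogeneous_tuple A ds xs \<longrightarrow>
        dend_inf_sum s \<mu> r ds xs = 0)"

text \<open>The underlying chain complex is concentrated in degrees \<open>0\<close> and \<open>d\<close>, with zero differential.\<close>

definition two_term ::
  "int \<Rightarrow> (int \<Rightarrow> 'v::ab_group_add set) \<Rightarrow>
     (nat \<Rightarrow> nat \<Rightarrow> (int \<Rightarrow>\<^sub>0 'v) list \<Rightarrow> (int \<Rightarrow>\<^sub>0 'v)) \<Rightarrow> bool"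
where
  "two_term d A \<mu> \<longleftrightarrow>
     (\<forall>i. i \<noteq> 0 \<and> i \<noteq> d \<longrightarrow> A i = {0}) \<and> (\<forall>x\<in>direct_sum A. \<mu> 1 1 [x] = 0)"

text \<open>
  The operations $\prec$, $\succ$ are the values at the labels 1, 2 of a family of bilinear maps.
  The three dendriform identities for \<open>a \<in> X\<close>, \<open>b \<in> Y\<close>, \<open>c \<in> Z\<close> are written for the products
  \<open>f\<close> on $X \times Y$, \<open>g\<close> on $(XY) \times Z$, \<open>h\<close> on $Y \times Z$ and \<open>k\<close> on $X \times (YZ)$, so
  that the same definition serves for algebras and for the three positions of a module element.
\<close>

definition dend_identities ::
  "(nat \<Rightarrow> 'v \<Rightarrow> 'v \<Rightarrow> 'v::ab_group_add) \<Rightarrow> (nat \<Rightarrow> 'v \<Rightarrow> 'v \<Rightarrow> 'v) \<Rightarrow>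
     (nat \<Rightarrow> 'v \<Rightarrow> 'v \<Rightarrow> 'v) \<Rightarrow> (nat \<Rightarrow> 'v \<Rightarrow> 'v \<Rightarrow> 'v) \<Rightarrow> 'v set \<Rightarrow> 'v set \<Rightarrow> 'v set \<Rightarrow> bool"
where
  "dend_identities f g h k X Y Z \<longleftrightarrow>
     (\<forall>a\<in>X. \<forall>b\<in>Y. \<forall>c\<in>Z.
        g 1 (f 1 a b) c = k 1 a (h 1 b c + h 2 b c) \<and>
        g 1 (f 2 a b) c = k 2 a (h 1 b c) \<and>
        g 2 (f 1 a b + f 2 a b) c = k 2 a (h 2 b c))"

definition dendriform_algebra ::
  "('k::field \<Rightarrow> 'v::ab_group_add \<Rightarrow> 'v) \<Rightarrow> 'v set \<Rightarrow> (nat \<Rightarrow> 'v \<Rightarrow> 'v \<Rightarrow> 'v) \<Rightarrow> bool"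
where
  "dendriform_algebra s A \<pi> \<longleftrightarrow>
     module.subspace s A \<and>
     \<pi> \<in> {1, 2} \<rightarrow>\<^sub>E bilinear_maps s A A A \<and>
     dend_identities \<pi> \<pi> \<pi> \<pi> A A A"

definition dend_representation ::
  "('k::field \<Rightarrow> 'v::ab_group_add \<Rightarrow> 'v) \<Rightarrow> 'v set \<Rightarrow> (nat \<Rightarrow> 'v \<Rightarrow> 'v \<Rightarrow> 'v) \<Rightarrow>
     'v set \<Rightarrow> (nat \<Rightarrow> 'v \<Rightarrow> 'v \<Rightarrow> 'v) \<Rightarrow> (nat \<Rightarrow> 'v \<Rightarrow> 'v \<Rightarrow> 'v) \<Rightarrow> bool"
where
  "dend_representation s A \<pi> M \<theta>1 \<theta>2 \<longleftrightarrow>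
     module.subspace s M \<and>
     \<theta>1 \<in> {1, 2} \<rightarrow>\<^sub>E bilinear_maps s A M M \<and>
     \<theta>2 \<in> {1, 2} \<rightarrow>\<^sub>E bilinear_maps s M A M \<and>
     dend_identities \<theta>2 \<theta>2 \<pi> \<theta>2 M A A \<and>
     dend_identities \<theta>1 \<theta>2 \<theta>2 \<theta>1 A M A \<and>
     dend_identities \<pi> \<theta>1 \<theta>1 \<theta>1 A A M"

text \<open>
  A linear map from $K[C_k] \otimes A^{\otimes k}$ to $M$ is a family, indexed by $C_k$, of
  \<open>k\<close>-linear maps.
\<close>

definition dend_cochains ::
  "('k::field \<Rightarrow> 'v::ab_group_add \<Rightarrow> 'v) \<Rightarrow> 'v set \<Rightarrow> 'v set \<Rightarrow> nat \<Rightarrow> (nat \<Rightarrow> 'v list \<Rightarrow> 'v) set"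
where
  "dend_cochains s A M k = (\<Pi>\<^sub>E r\<in>{1..k}. multilinear_maps s s k A M)"

text \<open>Lists count from 0, so $a_i$ is \<open>as ! (i - 1)\<close>.\<close>

definition dend_coboundary ::
  "('k::field \<Rightarrow> 'v::ab_group_add \<Rightarrow> 'v) \<Rightarrow> (nat \<Rightarrow> 'v \<Rightarrow> 'v \<Rightarrow> 'v) \<Rightarrow>
     (nat \<Rightarrow> 'v \<Rightarrow> 'v \<Rightarrow> 'v) \<Rightarrow> (nat \<Rightarrow> 'v \<Rightarrow> 'v \<Rightarrow> 'v) \<Rightarrow>
     nat \<Rightarrow> (nat \<Rightarrow> 'v list \<Rightarrow> 'v) \<Rightarrow> nat \<Rightarrow> 'v list \<Rightarrow> 'v"
where
  "dend_coboundary s \<pi> \<theta>1 \<theta>2 k f r as =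
     \<theta>1 (R0 2 k 2 r) (as ! 0) (extend_label s k (R 2 k 2 r) (\<lambda>t. f t (drop 1 as)))
     + (\<Sum>i=1..k. s ((- 1) ^ i)
          (f (R0 k 2 i r)
             (take (i - 1) as
              @ [extend_label s 2 (R k 2 i r) (\<lambda>t. \<pi> t (as ! (i - 1)) (as ! i))]
              @ drop (i + 1) as)))
     + s ((- 1) ^ (k + 1))
         (\<theta>2 (R0 2 k 1 r) (extend_label s k (R 2 k 1 r) (\<lambda>t. f t (take k as))) (as ! k))"

definition dend_cocycle ::
  "('k::field \<Rightarrow> 'v::ab_group_add \<Rightarrow> 'v) \<Rightarrow> 'v set \<Rightarrow> (nat \<Rightarrow> 'v \<Rightarrow> 'v \<Rightarrow> 'v) \<Rightarrow> 'v set \<Rightarrow>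
     (nat \<Rightarrow> 'v \<Rightarrow> 'v \<Rightarrow> 'v) \<Rightarrow> (nat \<Rightarrow> 'v \<Rightarrow> 'v \<Rightarrow> 'v) \<Rightarrow> nat \<Rightarrow> (nat \<Rightarrow> 'v list \<Rightarrow> 'v) \<Rightarrow> bool"
where
  "dend_cocycle s A \<pi> M \<theta>1 \<theta>2 k f \<longleftrightarrow>
     f \<in> dend_cochains s A M k \<and>
     (\<forall>r\<in>{1..k+1}. \<forall>as\<in>tuples (k + 1) A. dend_coboundary s \<pi> \<theta>1 \<theta>2 k f r as = 0)"

text \<open>
  For \<open>p\<close>, \<open>q\<close>, \<open>e\<close> the degrees of the two arguments and of the result, the restriction of
  \<open>\<mu> 2\<close> to \<open>A p \<times> A q \<rightarrow> A e\<close>.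
\<close>

definition binary_component ::
  "(int \<Rightarrow> 'v::ab_group_add set) \<Rightarrow> (nat \<Rightarrow> nat \<Rightarrow> (int \<Rightarrow>\<^sub>0 'v) list \<Rightarrow> (int \<Rightarrow>\<^sub>0 'v)) \<Rightarrow>
     int \<Rightarrow> int \<Rightarrow> int \<Rightarrow> (nat \<Rightarrow> 'v \<Rightarrow> 'v \<Rightarrow> 'v)"
where
  "binary_component A \<mu> p q e =
     (\<lambda>r\<in>{1, 2}. \<lambda>x\<in>A p. \<lambda>y\<in>A q.
        Poly_Mapping.lookup (\<mu> 2 r [Poly_Mapping.single p x, Poly_Mapping.single q y]) e)"

text \<open>
  The correspondence: with \<open>d = n - 1\<close>, the algebra is \<open>A 0\<close>, the representation is \<open>A d\<close>, their
  operations are the components of \<open>\<mu> 2\<close>, and the cocycle is \<open>\<mu> (n + 1)\<close> from degree 0 to degree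
  \<open>d\<close>. The result is the tuple $((A,\pi_A),M,\theta_1,\theta_2,\sigma)$.
\<close>

definition dend_inf_to_cocycle ::
  "nat \<Rightarrow> (int \<Rightarrow> 'v::ab_group_add set) \<times> (nat \<Rightarrow> nat \<Rightarrow> (int \<Rightarrow>\<^sub>0 'v) list \<Rightarrow> (int \<Rightarrow>\<^sub>0 'v)) \<Rightarrow>
     ('v set \<times> (nat \<Rightarrow> 'v \<Rightarrow> 'v \<Rightarrow> 'v)) \<times> 'v set \<times> (nat \<Rightarrow> 'v \<Rightarrow> 'v \<Rightarrow> 'v) \<times>
     (nat \<Rightarrow> 'v \<Rightarrow> 'v \<Rightarrow> 'v) \<times> (nat \<Rightarrow> 'v list \<Rightarrow> 'v)"
where
  "dend_inf_to_cocycle n = (\<lambda>(A, \<mu>). let d = int n - 1 in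
     ((A 0, binary_component A \<mu> 0 0 0), A d,
      binary_component A \<mu> 0 d d, binary_component A \<mu> d 0 d,
      \<lambda>r\<in>{1..n+1}. \<lambda>as\<in>tuples (n + 1) (A 0).
        Poly_Mapping.lookup (\<mu> (n + 1) r (map (Poly_Mapping.single 0) as)) d))"

end

theory Submission
  imports Defs
begin

text \<open>
  Put \<open>d = n - 1\<close>, so that \<open>d \<ge> 1\<close>. An operation of arity \<open>k\<close> changes degrees by \<open>k - 2\<close>; on
  homogeneous inputs of which \<open>m\<close> have degree \<open>d\<close> and the others degree \<open>0\<close>, its value has degree
  \<open>m d + k - 2\<close>. Only the degrees \<open>0\<close> and \<open>d\<close> carry nonzero elements, and \<open>\<mu>\<^sub>1 = 0\<close>. Hence a
  nonzero value requires \<open>k = 2\<close> and \<open>m \<le> 1\<close>, or \<open>k = n + 1\<close> and \<open>m = 0\<close>. The operations thus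
  amount to a pair of products on \<open>A\<^sub>0\<close>, two pairs of actions of \<open>A\<^sub>0\<close> on \<open>A\<^sub>d\<close>, and a family
  of \<open>(n + 1)\<close>-linear maps from \<open>A\<^sub>0\<close> to \<open>A\<^sub>d\<close> (lemma \<open>two_term_components\<close>); every choice of
  such data comes from operations of the right degrees (\<open>dend_inf_to_cocycle_\<mu>\<close>).

  It remains to read off the identities. The one for \<open>N\<close> inputs is a signed sum of composites
  of operations of arities \<open>i\<close> and \<open>j\<close> with \<open>i + j = N + 1\<close>, so only \<open>i\<close>, \<open>j\<close> in \<open>{2, n + 1}\<close>
  contribute, and \<open>i = j = n + 1\<close> does not, because the inner value has degree \<open>d\<close>.

  For \<open>N = 3\<close> the sum is the difference of the two sides of a dendriform identity, the label
  \<open>r\<close> selecting which of the three. Its component of degree \<open>0\<close> concerns the products of \<open>A\<^sub>0\<close>,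
  and its component of degree \<open>d\<close> is the sum of the three defects with one argument in \<open>A\<^sub>d\<close>,
  which can be separated by the choice of the inputs (\<open>dend_inf_sum_3\<close>).

  For \<open>N = n + 2\<close> the sum is the coboundary of the \<open>(n + 1)\<close>-linear family at the components of
  degree \<open>0\<close> of the inputs, with the same signs (\<open>dend_inf_sum_Suc_Suc_n\<close>): inserting a product
  at position \<open>l\<close> gives the middle terms, and inserting \<open>\<mu>\<^bsub>n+1\<^esub>\<close> into a product gives the two
  outer ones.
\<close>

section \<open>Multilinear maps on tuples\<close>

lemma linear_on_zero:
  assumes "linear_on s1 s2 U f" "0 \<in> U"
  shows "f 0 = 0"
proof -
  have "f (0 + 0) = f 0 + f 0"
    using assms unfolding linear_on_def by blast
  then show ?thesis by simp
qed

lemma tuples_update: "xs \<in> tuples k U \<Longrightarrow> x \<in> U \<Longrightarrow> xs[p := x] \<in> tuples k U"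
  unfolding tuples_def using set_update_subset_insert[of xs p x] by auto

lemma tuples_nth: "xs \<in> tuples k U \<Longrightarrow> p < k \<Longrightarrow> xs ! p \<in> U"
  unfolding tuples_def by auto

lemma tuples_take_drop: "xs \<in> tuples N U \<Longrightarrow> p + i \<le> N \<Longrightarrow> take i (drop p xs) \<in> tuples i U"
  unfolding tuples_def by (auto dest!: in_set_takeD in_set_dropD)

lemma take_2_drop: "p + 1 < length xs \<Longrightarrow> take 2 (drop p xs) = [xs ! p, xs ! (p + 1)]"
  by (simp add: numeral_2_eq_2 take_Suc_conv_app_nth)

lemma multilinear_maps_mem:
  "f \<in> multilinear_maps s1 s2 k U W \<Longrightarrow> xs \<in> tuples k U \<Longrightarrow> f xs \<in> W"
  unfolding multilinear_maps_def by blast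

lemma multilinear_maps_linear:
  "f \<in> multilinear_maps s1 s2 k U W \<Longrightarrow> xs \<in> tuples k U \<Longrightarrow> p < k \<Longrightarrow>
     linear_on s1 s2 U (\<lambda>x. f (xs[p := x]))"
  unfolding multilinear_maps_def by blast

lemma multilinear_maps_zero:
  assumes "f \<in> multilinear_maps s1 s2 k U W" "xs \<in> tuples k U" "0 \<in> set xs"
  shows "f xs = 0"
proof -
  obtain p where p: "p < k" "xs ! p = 0"
    using assms(2,3) by (auto simp: tuples_def in_set_conv_nth)
  have "linear_on s1 s2 U (\<lambda>x. f (xs[p := x]))"
    using assms(1,2) p(1) by (rule multilinear_maps_linear)
  moreover have "0 \<in> U"
    using assms(2,3) by (auto simp: tuples_def)
  ultimately have "f (xs[p := 0]) = 0"
    by (rule linear_on_zero)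
  with p(2) show ?thesis
    by (metis list_update_id)
qed

text \<open>
  A multilinear map is determined by its values on tuples from \<open>H\<close> if every vector is a sum of two
  elements of \<open>H\<close>. The induction is on the number \<open>p\<close> of initial entries that may lie outside \<open>H\<close>.
\<close>

lemma multilinear_maps_eq:
  assumes f: "f \<in> multilinear_maps s1 s2 k U W" and g: "g \<in> multilinear_maps s1 s2 k U W"
    and H: "H \<subseteq> U" "\<And>x. x \<in> U \<Longrightarrow> \<exists>y\<in>H. \<exists>z\<in>H. x = y + z"
    and eq: "\<And>xs. xs \<in> tuples k H \<Longrightarrow> f xs = g xs"
    and xs: "xs \<in> tuples k U"
  shows "f xs = g xs"
proof -
  have "f xs = g xs" if "xs \<in> tuples k U" "\<And>q. p \<le> q \<Longrightarrow> q < k \<Longrightarrow> xs ! q \<in> H" for p xs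
    using that
  proof (induction p arbitrary: xs)
    case 0
    then have "xs \<in> tuples k H"
      by (auto simp: tuples_def in_set_conv_nth)
    then show ?case by (rule eq)
  next
    case (Suc p)
    show ?case
    proof (cases "p < k")
      case True
      with Suc.prems(1) have "xs ! p \<in> U" by (rule tuples_nth)
      then obtain y z where yz: "y \<in> H" "z \<in> H" "xs ! p = y + z"
        using H(2) by blast
      have IH: "f (xs[p := u]) = g (xs[p := u])" if "u \<in> H" for u
      proof (rule Suc.IH)
        show "xs[p := u] \<in> tuples k U"
          by (rule tuples_update) (use Suc.prems(1) that H(1) in auto)
        show "xs[p := u] ! q \<in> H" if "p \<le> q" "q < k" for q
        proof (cases "q = p")
          case True
          then show ?thesis
            using that(2) \<open>u \<in> H\<close> Suc.prems(1) by (simp add: tuples_def)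
        next
          case False
          then show ?thesis
            using Suc.prems(2)[of q] that by simp
        qed
      qed
      have split: "h xs = h (xs[p := y]) + h (xs[p := z])"
        if "h \<in> multilinear_maps s1 s2 k U W" for h
      proof -
        have "linear_on s1 s2 U (\<lambda>x. h (xs[p := x]))"
          using that Suc.prems(1) True by (rule multilinear_maps_linear)
        then have "h (xs[p := y + z]) = h (xs[p := y]) + h (xs[p := z])"
          using yz(1,2) H(1) unfolding linear_on_def by blast
        then show ?thesis
          by (metis yz(3) list_update_id)
      qed
      show ?thesis
        using split[OF f] split[OF g] IH[OF yz(1)] IH[OF yz(2)] by simp
    next
      case False
      then show ?thesis
        using Suc.prems by (intro Suc.IH) simp_all
    qed
  qed
  from this[of xs k] xs show ?thesis by simp
qed

lemma bilinear_mapsD: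
  assumes "f \<in> bilinear_maps s U V W"
  shows "x \<in> U \<Longrightarrow> y \<in> V \<Longrightarrow> f x y \<in> W"
    and "x \<in> U \<Longrightarrow> x' \<in> U \<Longrightarrow> y \<in> V \<Longrightarrow> f (x + x') y = f x y + f x' y"
    and "x \<in> U \<Longrightarrow> y \<in> V \<Longrightarrow> y' \<in> V \<Longrightarrow> f x (y + y') = f x y + f x y'"
    and "x \<in> U \<Longrightarrow> y \<in> V \<Longrightarrow> f (s c x) y = s c (f x y)"
    and "x \<in> U \<Longrightarrow> y \<in> V \<Longrightarrow> f x (s c y) = s c (f x y)"
    and "0 \<in> U \<Longrightarrow> y \<in> V \<Longrightarrow> f 0 y = 0"
    and "x \<in> U \<Longrightarrow> 0 \<in> V \<Longrightarrow> f x 0 = 0"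
proof -
  have *: "f \<in> U \<rightarrow>\<^sub>E (V \<rightarrow>\<^sub>E W)" "\<forall>x\<in>U. linear_on s s V (\<lambda>y. f x y)"
    "\<forall>y\<in>V. linear_on s s U (\<lambda>x. f x y)"
    using assms by (auto simp: bilinear_maps_def)
  show "x \<in> U \<Longrightarrow> y \<in> V \<Longrightarrow> f x y \<in> W"
    using *(1) by (metis PiE_mem)
  show "x \<in> U \<Longrightarrow> x' \<in> U \<Longrightarrow> y \<in> V \<Longrightarrow> f (x + x') y = f x y + f x' y"
    "x \<in> U \<Longrightarrow> y \<in> V \<Longrightarrow> f (s c x) y = s c (f x y)"
    using *(3) by (auto simp: linear_on_def)
  show "x \<in> U \<Longrightarrow> y \<in> V \<Longrightarrow> y' \<in> V \<Longrightarrow> f x (y + y') = f x y + f x y'"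
    "x \<in> U \<Longrightarrow> y \<in> V \<Longrightarrow> f x (s c y) = s c (f x y)"
    using *(2) by (auto simp: linear_on_def)
  show "0 \<in> U \<Longrightarrow> y \<in> V \<Longrightarrow> f 0 y = 0"
    using *(3) linear_on_zero[of s s U "\<lambda>x. f x y"] by blast
  show "x \<in> U \<Longrightarrow> 0 \<in> V \<Longrightarrow> f x 0 = 0"
    using *(2) linear_on_zero[of s s V "\<lambda>y. f x y"] by blast
qed

section \<open>Labels and graded vector spaces\<close>

lemma R0_mem:
  "1 \<le> i \<Longrightarrow> 1 \<le> l \<Longrightarrow> l \<le> j \<Longrightarrow> 1 \<le> r \<Longrightarrow> r \<le> i + j - 1 \<Longrightarrow> R0 j i l r \<in> {1..j}"
  by (auto simp: R0_def)

lemma sum_1_2: "(\<Sum>l=1..2. f l) = f 1 + f (2::nat)"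
  by (simp add: numeral_2_eq_2)

lemma member_le_sum_list_nonneg:
  fixes ds :: "'a::ordered_comm_monoid_add list"
  assumes "m \<in> set ds" "\<And>x. x \<in> set ds \<Longrightarrow> 0 \<le> x"
  shows "m \<le> sum_list ds"
  using assms
proof (induction ds)
  case (Cons x ds)
  then have "0 \<le> x" "0 \<le> sum_list ds"
    by (simp_all add: sum_list_nonneg)
  with Cons show ?case
    by (auto intro: add_increasing add_increasing2)
qed simp

lemma minus_one_powi: "(- 1 :: 'k::field) powi m = (if even m then 1 else - 1)"
proof (cases "even m")
  case True
  then obtain j where "m = 2 * j" by (elim evenE)
  then show ?thesis by (simp add: power_int_mult)
next
  case False
  then obtain j where "m = 2 * j + 1" by (elim oddE)
  then show ?thesis by (simp add: power_int_mult power_int_add)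
qed

text \<open>
  For operations \<open>f\<close>, \<open>g\<close>, \<open>h\<close>, \<open>k\<close> as in \<^const>\<open>dend_identities\<close>, the right-hand side
  minus the left-hand side of the \<open>r\<close>-th dendriform identity, with the labels written through \<^const>\<open>R0\<close> and
  \<^const>\<open>R\<close>.
\<close>

definition dend_defect ::
  "('k::field \<Rightarrow> 'v::ab_group_add \<Rightarrow> 'v) \<Rightarrow>
     (nat \<Rightarrow> 'v \<Rightarrow> 'v \<Rightarrow> 'v) \<Rightarrow> (nat \<Rightarrow> 'v \<Rightarrow> 'v \<Rightarrow> 'v) \<Rightarrow> (nat \<Rightarrow> 'v \<Rightarrow> 'v \<Rightarrow> 'v) \<Rightarrow>
     (nat \<Rightarrow> 'v \<Rightarrow> 'v \<Rightarrow> 'v) \<Rightarrow> nat \<Rightarrow> 'v \<Rightarrow> 'v \<Rightarrow> 'v \<Rightarrow> 'v"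
where
  "dend_defect s f g h k r a b c =
     k (R0 2 2 2 r) a (extend_label s 2 (R 2 2 2 r) (\<lambda>t. h t b c))
     - g (R0 2 2 1 r) (extend_label s 2 (R 2 2 1 r) (\<lambda>t. f t a b)) c"

context vector_space
begin

lemma lookup_scale_sum [simp]:
  "Poly_Mapping.lookup (scale_sum scale c x) i = scale c (Poly_Mapping.lookup x i)"
  by (auto simp: scale_sum_def map.rep_eq when_def)

lemma lookup_extend_label:
  "Poly_Mapping.lookup (extend_label (scale_sum scale) k v g) i =
     extend_label scale k v (\<lambda>t. Poly_Mapping.lookup (g t) i)"
  by (simp add: extend_label_def lookup_sum)

lemma extend_label_mem:
  "subspace W \<Longrightarrow> (\<And>t. t \<in> {1..k} \<Longrightarrow> g t \<in> W) \<Longrightarrow> extend_label scale k v g \<in> W"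
  unfolding extend_label_def by (intro subspace_sum subspace_scale) auto

lemma extend_label_add:
  "extend_label scale k v (\<lambda>t. g t + h t) = extend_label scale k v g + extend_label scale k v h"
  by (simp add: extend_label_def scale_right_distrib sum.distrib)

lemma extend_label_zero:
  "(\<And>t. t \<in> {1..k} \<Longrightarrow> g t = 0) \<Longrightarrow> extend_label scale k v g = 0"
  by (simp add: extend_label_def)

lemma extend_label_cong:
  "(\<And>t. t \<in> {1..k} \<Longrightarrow> g t = h t) \<Longrightarrow> extend_label scale k v g = extend_label scale k v h"
  by (simp add: extend_label_def)

lemma scale_sum_zero [simp]: "scale_sum scale c 0 = 0"
  by (rule poly_mapping_eqI) simp

lemma extend_label_2:
  "extend_label scale 2 u g = scale (u 1) (g 1) + scale (u 2) (g 2)"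
  unfolding extend_label_def by (rule sum_1_2)

lemma scale_sum_single:
  "scale_sum scale c (Poly_Mapping.single i m) = Poly_Mapping.single i (scale c m)"
  by (rule poly_mapping_eqI) (simp add: lookup_single when_def)

lemma dend_identities_iff_defect:
  "dend_identities f g h k X Y Z \<longleftrightarrow>
     (\<forall>r\<in>{1..3}. \<forall>a\<in>X. \<forall>b\<in>Y. \<forall>c\<in>Z. dend_defect scale f g h k r a b c = 0)"
proof -
  have labels: "{1..3::nat} = {1, 2, 3}" "{Suc 0..2} = {1, 2}" by auto
  have "dend_defect scale f g h k 1 a b c = k 1 a (h 1 b c + h 2 b c) - g 1 (f 1 a b) c"
    "dend_defect scale f g h k 2 a b c = k 2 a (h 1 b c) - g 1 (f 2 a b) c"
    "dend_defect scale f g h k 3 a b c = k 2 a (h 2 b c) - g 2 (f 1 a b + f 2 a b) c" for a b c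
    by (simp_all add: dend_defect_def R0_def R_def extend_label_def labels(2) flip: numeral_2_eq_2)
  then show ?thesis
    unfolding dend_identities_def labels(1) by (simp add: eq_commute[of "k _ _ _"]) blast
qed

end

text \<open>
  Since \<^const>\<open>bilinear_maps\<close> are extensional, the values on \<open>A p\<close> and \<open>A q\<close> determine them.
\<close>

lemma binary_component_eqI:
  fixes f :: "nat \<Rightarrow> 'v::ab_group_add \<Rightarrow> 'v \<Rightarrow> 'v"
  assumes "f \<in> {1, 2} \<rightarrow>\<^sub>E bilinear_maps s (A p) (A q) W"
    and "\<And>r x y. r \<in> {1, 2} \<Longrightarrow> x \<in> A p \<Longrightarrow> y \<in> A q \<Longrightarrow>
      Poly_Mapping.lookup (\<mu> 2 r [Poly_Mapping.single p x, Poly_Mapping.single q y]) e = f r x y"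
  shows "binary_component A \<mu> p q e = f"
proof (intro ext)
  fix r :: nat and x y :: 'v
  consider "r \<notin> {1, 2}" | "r \<in> {1, 2}" "x \<notin> A p" | "r \<in> {1, 2}" "x \<in> A p" "y \<notin> A q"
    | "r \<in> {1, 2}" "x \<in> A p" "y \<in> A q"
    by blast
  then show "binary_component A \<mu> p q e r x y = f r x y"
  proof cases
    case 1
    then show ?thesis
      using PiE_arb[OF assms(1), of r] by (simp add: binary_component_def)
  next
    case 2
    then have "f r \<in> A p \<rightarrow>\<^sub>E (A q \<rightarrow>\<^sub>E W)"
      using PiE_mem[OF assms(1)] by (simp add: bilinear_maps_def)
    then show ?thesis
      using 2 PiE_arb[of "f r" "A p" _ x] by (simp add: binary_component_def)
  next
    case 3
    then have "f r \<in> A p \<rightarrow>\<^sub>E (A q \<rightarrow>\<^sub>E W)"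
      using PiE_mem[OF assms(1)] by (simp add: bilinear_maps_def)
    then have "f r x \<in> A q \<rightarrow>\<^sub>E W"
      using 3(2) by (rule PiE_mem)
    then show ?thesis
      using 3 PiE_arb[of "f r x" "A q" _ y] by (simp add: binary_component_def)
  next
    case 4
    then show ?thesis
      using assms(2) by (simp add: binary_component_def)
  qed
qed

section \<open>Rebuilding the operations of a two-term algebra\<close>

text \<open>The graded space with \<open>A\<close> in degree \<open>0\<close>, \<open>M\<close> in degree \<open>d\<close> and \<open>0\<close> elsewhere.\<close>

definition two_term_space :: "int \<Rightarrow> 'v::ab_group_add set \<Rightarrow> 'v set \<Rightarrow> int \<Rightarrow> 'v set" where
  "two_term_space d A M = (\<lambda>i. if i = 0 then A else if i = d then M else {0})"

text \<open>
  The operations with given components. The dendriform products and actions together form the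
  binary operation; \<open>\<sigma>\<close>, applied to the components of degree \<open>0\<close>, is the \<open>(n + 1)\<close>-ary one. All
  other operations vanish. Restriction to the labels and tuples on which the operations are
  defined makes them extensional.
\<close>

definition two_term_ops ::
  "int \<Rightarrow> nat \<Rightarrow> 'v::ab_group_add set \<Rightarrow> 'v set \<Rightarrow> (nat \<Rightarrow> 'v \<Rightarrow> 'v \<Rightarrow> 'v) \<Rightarrow> (nat \<Rightarrow> 'v \<Rightarrow> 'v \<Rightarrow> 'v) \<Rightarrow>
     (nat \<Rightarrow> 'v \<Rightarrow> 'v \<Rightarrow> 'v) \<Rightarrow> (nat \<Rightarrow> 'v list \<Rightarrow> 'v) \<Rightarrow>
     nat \<Rightarrow> nat \<Rightarrow> (int \<Rightarrow>\<^sub>0 'v) list \<Rightarrow> (int \<Rightarrow>\<^sub>0 'v)"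
where
  "two_term_ops d n A M \<pi> \<theta>1 \<theta>2 \<sigma> =
     (\<lambda>k\<in>{1..}. \<lambda>r\<in>{1..k}. \<lambda>xs\<in>tuples k (direct_sum (two_term_space d A M)).
       if k = 2 then
         Poly_Mapping.single 0
           (\<pi> r (Poly_Mapping.lookup (xs ! 0) 0) (Poly_Mapping.lookup (xs ! 1) 0))
         + Poly_Mapping.single d
           (\<theta>1 r (Poly_Mapping.lookup (xs ! 0) 0) (Poly_Mapping.lookup (xs ! 1) d)
            + \<theta>2 r (Poly_Mapping.lookup (xs ! 0) d) (Poly_Mapping.lookup (xs ! 1) 0))
       else if k = n + 1 then
         Poly_Mapping.single d (\<sigma> r (map (\<lambda>x. Poly_Mapping.lookup x 0) xs))
       else 0)"

text \<open>
  Components of a two-term structure, multilinear but not yet subject to any identity.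
\<close>

locale two_term_data = vector_space scale
  for scale :: "'k::field \<Rightarrow> 'v::ab_group_add \<Rightarrow> 'v" +
  fixes n :: nat
    and d :: int
    and A M :: "'v set"
    and \<pi> \<theta>1 \<theta>2 :: "nat \<Rightarrow> 'v \<Rightarrow> 'v \<Rightarrow> 'v"
    and \<sigma> :: "nat \<Rightarrow> 'v list \<Rightarrow> 'v"
  assumes n: "n \<ge> 2"
    and d: "d = int n - 1"
    and subspace_A: "subspace A"
    and subspace_M: "subspace M"
    and \<pi>: "\<pi> \<in> {1, 2} \<rightarrow>\<^sub>E bilinear_maps scale A A A"
    and \<theta>1: "\<theta>1 \<in> {1, 2} \<rightarrow>\<^sub>E bilinear_maps scale A M M"
    and \<theta>2: "\<theta>2 \<in> {1, 2} \<rightarrow>\<^sub>E bilinear_maps scale M A M"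
    and \<sigma>: "\<sigma> \<in> dend_cochains scale A M (n + 1)"
begin

abbreviation V :: "int \<Rightarrow> 'v set" where "V \<equiv> two_term_space d A M"
abbreviation \<mu> :: "nat \<Rightarrow> nat \<Rightarrow> (int \<Rightarrow>\<^sub>0 'v) list \<Rightarrow> (int \<Rightarrow>\<^sub>0 'v)" where
  "\<mu> \<equiv> two_term_ops d n A M \<pi> \<theta>1 \<theta>2 \<sigma>"
text \<open>The components of degree \<open>0\<close> and \<open>d\<close>.\<close>

abbreviation lo :: "(int \<Rightarrow>\<^sub>0 'v) \<Rightarrow> 'v" where "lo x \<equiv> Poly_Mapping.lookup x 0"
abbreviation hi :: "(int \<Rightarrow>\<^sub>0 'v) \<Rightarrow> 'v" where "hi x \<equiv> Poly_Mapping.lookup x d"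

lemma d_neq_0 [simp]: "d \<noteq> 0" "0 \<noteq> d"
  using n d by auto

lemma subspace_V: "subspace (V i)"
  by (simp add: two_term_space_def subspace_A subspace_M)

lemma zero_mem [simp]: "0 \<in> A" "0 \<in> M"
  using subspace_A subspace_M subspace_0 by auto

lemma V_simps [simp]: "V 0 = A" "V d = M"
  using n by (auto simp: two_term_space_def)

lemma direct_sum_V: "x \<in> direct_sum V \<longleftrightarrow>
    lo x \<in> A \<and> hi x \<in> M \<and> (\<forall>i. i \<noteq> 0 \<longrightarrow> i \<noteq> d \<longrightarrow> Poly_Mapping.lookup x i = 0)"
proof
  assume "x \<in> direct_sum V"
  then have *: "Poly_Mapping.lookup x i \<in> V i" for i
    by (simp add: direct_sum_def)
  have "Poly_Mapping.lookup x i = 0" if "i \<noteq> 0" "i \<noteq> d" for i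
    using *[of i] that by (simp add: two_term_space_def)
  then show "lo x \<in> A \<and> hi x \<in> M \<and> (\<forall>i. i \<noteq> 0 \<longrightarrow> i \<noteq> d \<longrightarrow> Poly_Mapping.lookup x i = 0)"
    using *[of 0] *[of d] by simp
next
  assume *: "lo x \<in> A \<and> hi x \<in> M \<and> (\<forall>i. i \<noteq> 0 \<longrightarrow> i \<noteq> d \<longrightarrow> Poly_Mapping.lookup x i = 0)"
  have "Poly_Mapping.lookup x i \<in> V i" for i
    using * by (cases "i = 0"; cases "i = d") (simp_all add: two_term_space_def)
  then show "x \<in> direct_sum V"
    by (simp add: direct_sum_def)
qed

lemma lo_mem: "x \<in> direct_sum V \<Longrightarrow> lo x \<in> A"
  and hi_mem: "x \<in> direct_sum V \<Longrightarrow> hi x \<in> M"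
  by (simp_all add: direct_sum_V)

lemma direct_sum_closed [simp]:
  "0 \<in> direct_sum V"
  "x \<in> direct_sum V \<Longrightarrow> y \<in> direct_sum V \<Longrightarrow> x + y \<in> direct_sum V"
  "x \<in> direct_sum V \<Longrightarrow> scale_sum scale c x \<in> direct_sum V"
  "a \<in> A \<Longrightarrow> Poly_Mapping.single 0 a \<in> direct_sum V"
  "m \<in> M \<Longrightarrow> Poly_Mapping.single d m \<in> direct_sum V"
  using subspace_A subspace_M
  by (simp_all add: direct_sum_V lookup_add lookup_single subspace_add subspace_scale)

lemma direct_sum_extend_label:
  "(\<And>t. t \<in> {1..k} \<Longrightarrow> g t \<in> direct_sum V) \<Longrightarrow>
     extend_label (scale_sum scale) k v g \<in> direct_sum V"
  unfolding direct_sum_def mem_Collect_eq lookup_extend_label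
  by (intro allI extend_label_mem subspace_V) auto

lemmas \<pi>_bilinear = bilinear_mapsD[OF PiE_mem[OF \<pi>]]
lemmas \<theta>1_bilinear = bilinear_mapsD[OF PiE_mem[OF \<theta>1]]
lemmas \<theta>2_bilinear = bilinear_mapsD[OF PiE_mem[OF \<theta>2]]
lemmas ops_bilinear = \<pi>_bilinear \<theta>1_bilinear \<theta>2_bilinear

lemma \<sigma>_multilinear: "r \<in> {1..n+1} \<Longrightarrow> \<sigma> r \<in> multilinear_maps scale scale (n + 1) A M"
  using \<sigma> unfolding dend_cochains_def by (rule PiE_mem)

lemma \<sigma>_mem: "r \<in> {1..n+1} \<Longrightarrow> as \<in> tuples (n + 1) A \<Longrightarrow> \<sigma> r as \<in> M"
  using \<sigma>_multilinear[of r] unfolding multilinear_maps_def by blast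

lemma map_lo_tuples: "xs \<in> tuples k (direct_sum V) \<Longrightarrow> map lo xs \<in> tuples k A"
  by (auto simp: tuples_def lo_mem)

lemma \<mu>_2:
  assumes "r \<in> {1, 2}" "x \<in> direct_sum V" "y \<in> direct_sum V"
  shows "\<mu> 2 r [x, y] = Poly_Mapping.single 0 (\<pi> r (lo x) (lo y))
    + Poly_Mapping.single d (\<theta>1 r (lo x) (hi y) + \<theta>2 r (hi x) (lo y))"
  using assms by (auto simp: two_term_ops_def tuples_def)

lemma \<mu>_2_lookup:
  assumes "r \<in> {1, 2}" "x \<in> direct_sum V" "y \<in> direct_sum V"
  shows "lo (\<mu> 2 r [x, y]) = \<pi> r (lo x) (lo y)"
    and "hi (\<mu> 2 r [x, y]) = \<theta>1 r (lo x) (hi y) + \<theta>2 r (hi x) (lo y)"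
  using assms by (simp_all add: \<mu>_2 lookup_add lookup_single when_def)

lemma \<mu>_Suc_n:
  assumes "r \<in> {1..n+1}" "xs \<in> tuples (n + 1) (direct_sum V)"
  shows "\<mu> (Suc n) r xs = Poly_Mapping.single d (\<sigma> r (map lo xs))"
  using assms n by (auto simp: two_term_ops_def)

lemma \<mu>_other:
  assumes "k \<noteq> 2" "k \<noteq> n + 1" "r \<in> {1..k}" "xs \<in> tuples k (direct_sum V)"
  shows "\<mu> k r xs = 0"
  using assms by (auto simp: two_term_ops_def)

lemma \<mu>_mem:
  assumes "k \<ge> 1" "r \<in> {1..k}" "xs \<in> tuples k (direct_sum V)"
  shows "\<mu> k r xs \<in> direct_sum V"
proof -
  consider "k = 2" | "k = n + 1" | "k \<noteq> 2" "k \<noteq> n + 1" by blast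
  then show ?thesis
  proof cases
    case 1
    then obtain x y where "xs = [x, y]"
      using assms(3) by (auto simp: tuples_def numeral_2_eq_2 length_Suc_conv)
    moreover have "r \<in> {1, 2}" using 1 assms(2) by auto
    ultimately show ?thesis
      using assms(3) 1
      by (auto simp: \<mu>_2 tuples_def lo_mem hi_mem ops_bilinear subspace_M subspace_add)
  next
    case 2
    then show ?thesis
      using assms \<mu>_Suc_n[of r xs] \<sigma>_mem[of r "map lo xs"] map_lo_tuples[of xs] by simp
  qed (use assms in \<open>simp add: \<mu>_other\<close>)
qed

lemma \<mu>_2_bilinear:
  assumes "r \<in> {1, 2}" "x \<in> direct_sum V" "y \<in> direct_sum V"
  shows "x' \<in> direct_sum V \<Longrightarrow> \<mu> 2 r [x + x', y] = \<mu> 2 r [x, y] + \<mu> 2 r [x', y]"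
    and "y' \<in> direct_sum V \<Longrightarrow> \<mu> 2 r [x, y + y'] = \<mu> 2 r [x, y] + \<mu> 2 r [x, y']"
    and "\<mu> 2 r [scale_sum scale c x, y] = scale_sum scale c (\<mu> 2 r [x, y])"
    and "\<mu> 2 r [x, scale_sum scale c y] = scale_sum scale c (\<mu> 2 r [x, y])"
proof -
  note mem = assms(2,3) assms(2,3)[THEN lo_mem] assms(2,3)[THEN hi_mem]
  note expand = \<mu>_2[OF assms(1)] lookup_add lookup_single when_def ops_bilinear[OF assms(1)]
    scale_right_distrib
  show "\<mu> 2 r [x + x', y] = \<mu> 2 r [x, y] + \<mu> 2 r [x', y]" if "x' \<in> direct_sum V"
    using that[THEN lo_mem] that[THEN hi_mem]
    by (intro poly_mapping_eqI) (simp add: expand mem that)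
  show "\<mu> 2 r [x, y + y'] = \<mu> 2 r [x, y] + \<mu> 2 r [x, y']" if "y' \<in> direct_sum V"
    using that[THEN lo_mem] that[THEN hi_mem]
    by (intro poly_mapping_eqI) (simp add: expand mem that)
  show "\<mu> 2 r [scale_sum scale c x, y] = scale_sum scale c (\<mu> 2 r [x, y])"
    by (intro poly_mapping_eqI) (simp add: expand mem)
  show "\<mu> 2 r [x, scale_sum scale c y] = scale_sum scale c (\<mu> 2 r [x, y])"
    by (intro poly_mapping_eqI) (simp add: expand mem)
qed

lemma \<mu>_multilinear:
  assumes "k \<ge> 1" "r \<in> {1..k}"
  shows "\<mu> k r \<in> multilinear_maps (scale_sum scale) (scale_sum scale) k (direct_sum V) (direct_sum V)"
proof -
  have "linear_on (scale_sum scale) (scale_sum scale) (direct_sum V) (\<lambda>x. \<mu> k r (xs[p := x]))"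
    if xs: "xs \<in> tuples k (direct_sum V)" and p: "p < k" for xs p
  proof -
    have upd: "xs[p := x] \<in> tuples k (direct_sum V)" if "x \<in> direct_sum V" for x
      using that xs by (rule tuples_update[rotated])
    consider "k = 2" | "k = n + 1" | "k \<noteq> 2" "k \<noteq> n + 1" by blast
    then show ?thesis
    proof cases
      case 1
      then obtain a b where ab: "xs = [a, b]"
        using xs by (auto simp: tuples_def numeral_2_eq_2 length_Suc_conv)
      have r: "r \<in> {1, 2}" using 1 assms(2) by auto
      have abV: "a \<in> direct_sum V" "b \<in> direct_sum V"
        using xs ab by (auto simp: tuples_def)
      have "p = 0 \<or> p = 1" using p 1 by auto
      then show ?thesis
        using abV by (auto simp: linear_on_def 1 ab \<mu>_2_bilinear[OF r])
    next
      case 2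
      have lin: "linear_on scale scale A (\<lambda>a. \<sigma> r ((map lo xs)[p := a]))"
        using \<sigma>_multilinear[of r] map_lo_tuples[OF xs] p 2 assms(2)
        by (simp add: multilinear_maps_def)
      have eq: "\<mu> k r (xs[p := x]) = Poly_Mapping.single d (\<sigma> r ((map lo xs)[p := lo x]))"
        if "x \<in> direct_sum V" for x
        using \<mu>_Suc_n[of r "xs[p := x]"] upd[OF that] assms(2) 2 by (simp add: map_update)
      show ?thesis
        using lin unfolding linear_on_def
        by (auto simp: eq lookup_add lookup_single lo_mem single_add[symmetric]
            intro!: poly_mapping_eqI simp: when_def)
    qed (use assms upd in \<open>simp add: linear_on_def \<mu>_other\<close>)
  qed
  moreover have "\<mu> k r \<in> tuples k (direct_sum V) \<rightarrow>\<^sub>E direct_sum V"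
  proof (rule PiE_I)
    show "\<mu> k r xs = undefined" if "xs \<notin> tuples k (direct_sum V)" for xs
      using that assms by (simp add: two_term_ops_def)
  qed (rule \<mu>_mem[OF assms])
  ultimately show ?thesis
    by (simp add: multilinear_maps_def)
qed

lemma \<mu>_PiE:
  "\<mu> \<in> (\<Pi>\<^sub>E k\<in>{1..}. \<Pi>\<^sub>E r\<in>{1..k}.
     multilinear_maps (scale_sum scale) (scale_sum scale) k (direct_sum V) (direct_sum V))"
proof (intro PiE_I)
  show "\<mu> k r \<in> multilinear_maps (scale_sum scale) (scale_sum scale) k (direct_sum V) (direct_sum V)"
    if "k \<in> {1..}" "r \<in> {1..k}" for k r
    using that by (intro \<mu>_multilinear) simp_all
qed (auto simp: two_term_ops_def)

lemma two_term_\<mu>: "two_term d V \<mu>"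
  unfolding two_term_def
proof (intro conjI ballI)
  show "\<mu> 1 1 [x] = 0" if "x \<in> direct_sum V" for x
    using that n by (intro \<mu>_other) (auto simp: tuples_def)
qed (simp add: two_term_space_def)

lemma homogeneous_tuple_mem:
  "homogeneous_tuple V ds xs \<Longrightarrow> xs \<in> tuples (length xs) (direct_sum V)"
proof -
  have sub: "homogeneous V e \<subseteq> direct_sum V" for e
    by (auto simp: homogeneous_def direct_sum_def lookup_single when_def subspace_0[OF subspace_V])
  show "xs \<in> tuples (length xs) (direct_sum V)" if "homogeneous_tuple V ds xs"
    using that sub unfolding homogeneous_tuple_def tuples_def
    by (induction ds xs rule: list_all2_induct) auto
qed

lemma homogeneous_nth_lo:
  assumes "homogeneous_tuple V ds xs" "p < length xs" "ds ! p \<noteq> 0"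
  shows "lo (xs ! p) = 0"
proof -
  have "xs ! p \<in> homogeneous V (ds ! p)"
    using assms(1,2) by (simp add: homogeneous_tuple_def list_all2_conv_all_nth)
  then show ?thesis
    using assms(3) by (auto simp: homogeneous_def lookup_single)
qed

lemma zero_homogeneous: "0 \<in> homogeneous V e"
  unfolding homogeneous_def by (rule image_eqI[of _ _ 0]) (simp_all add: subspace_0 subspace_V)

lemma \<sigma>_zero:
  assumes "r \<in> {1..n+1}" "as \<in> tuples (n + 1) A" "0 \<in> set as"
  shows "\<sigma> r as = 0"
  using multilinear_maps_zero[OF \<sigma>_multilinear] assms by blast

text \<open>
  Where the degrees of the inputs are not those of one of the given components, the value is \<open>0\<close>,
  which is homogeneous of every degree.
\<close>

lemma \<mu>_homogeneous:
  assumes k: "k \<ge> 1" "r \<in> {1..k}" and len: "length xs = k" and hom: "homogeneous_tuple V ds xs"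
  shows "\<mu> k r xs \<in> homogeneous V (sum_list ds + int k - 2)"
proof -
  have xs: "xs \<in> tuples k (direct_sum V)"
    using homogeneous_tuple_mem[OF hom] len by simp
  consider "k = 2" | "k = n + 1" | "k \<noteq> 2" "k \<noteq> n + 1" by blast
  then show ?thesis
  proof cases
    case 1
    then obtain x y where xy: "xs = [x, y]"
      using xs by (auto simp: tuples_def numeral_2_eq_2 length_Suc_conv)
    then obtain p q where pq: "ds = [p, q]"
      using hom by (auto simp: homogeneous_tuple_def list_all2_Cons2)
    obtain a b where ab: "x = Poly_Mapping.single p a" "a \<in> V p"
      "y = Poly_Mapping.single q b" "b \<in> V q"
      using hom unfolding xy pq by (auto simp: homogeneous_tuple_def homogeneous_def)
    have r: "r \<in> {1, 2}" using 1 k(2) by auto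
    have V: "x \<in> direct_sum V" "y \<in> direct_sum V"
      using xs by (auto simp: xy tuples_def)
    have "lo x \<in> A" "lo y \<in> A" "hi x \<in> M" "hi y \<in> M"
      using V by (simp_all add: lo_mem hi_mem)
    note mem = this ops_bilinear[OF r]
    consider "p = 0" "q = 0" | "p = 0" "q = d" | "p = d" "q = 0" | "p = d" "q = d"
      | "x = 0" | "y = 0"
      using ab by (auto simp: two_term_space_def split: if_splits)
    then have "\<mu> 2 r [x, y] \<in> homogeneous V (p + q)"
    proof cases
      case 1
      then show ?thesis
        unfolding \<mu>_2[OF r V] using ab by (simp add: mem homogeneous_def lookup_single)
    next
      case 2
      then show ?thesis
        unfolding \<mu>_2[OF r V] using ab by (simp add: mem homogeneous_def lookup_single)
    next
      case 3
      then show ?thesis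
        unfolding \<mu>_2[OF r V] using ab by (simp add: mem homogeneous_def lookup_single)
    next
      case 4
      then show ?thesis
        unfolding \<mu>_2[OF r V] using ab by (simp add: mem zero_homogeneous lookup_single)
    next
      case 5
      then show ?thesis
        unfolding \<mu>_2[OF r V] by (simp add: mem zero_homogeneous)
    next
      case 6
      then show ?thesis
        unfolding \<mu>_2[OF r V] by (simp add: mem zero_homogeneous)
    qed
    then show ?thesis
      using 1 by (simp add: xy pq)
  next
    case 2
    have \<mu>: "\<mu> k r xs = Poly_Mapping.single d (\<sigma> r (map lo xs))"
      using \<mu>_Suc_n k xs 2 by simp
    have lo: "map lo xs \<in> tuples (n + 1) A"
      using map_lo_tuples[OF xs] 2 by simp
    show ?thesis
    proof (cases "\<forall>p<k. ds ! p = 0")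
      case True
      moreover have "length ds = k"
        using hom len by (simp add: homogeneous_tuple_def list_all2_conv_all_nth)
      ultimately have "sum_list ds = 0"
        by (simp add: sum_list_sum_nth)
      then have e: "sum_list ds + int k - 2 = d"
        using d 2 by simp
      have "\<sigma> r (map lo xs) \<in> M"
        using \<sigma>_mem[OF _ lo] k(2) unfolding 2 .
      then show ?thesis
        unfolding \<mu> e homogeneous_def V_simps by (rule imageI)
    next
      case False
      then obtain p where "p < k" "lo (xs ! p) = 0"
        using homogeneous_nth_lo[OF hom] len by auto
      then have "0 \<in> set (map lo xs)"
        using len by (metis length_map nth_map nth_mem)
      then have "\<sigma> r (map lo xs) = 0"
        using \<sigma>_zero lo k 2 by blast
      then show ?thesis by (simp add: \<mu> zero_homogeneous)
    qed
  qed (use k xs in \<open>simp add: \<mu>_other zero_homogeneous\<close>)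
qed

lemma dend_inf_to_cocycle_\<mu>: "dend_inf_to_cocycle n (V, \<mu>) = ((A, \<pi>), M, \<theta>1, \<theta>2, \<sigma>)"
proof -
  have 1: "binary_component V \<mu> 0 0 0 = \<pi>"
    using \<pi> by (intro binary_component_eqI) (simp_all add: \<mu>_2_lookup del: insert_iff)
  have 2: "binary_component V \<mu> 0 d d = \<theta>1"
    using \<theta>1 by (intro binary_component_eqI)
      (simp_all add: \<mu>_2_lookup lookup_single ops_bilinear del: insert_iff)
  have 3: "binary_component V \<mu> d 0 d = \<theta>2"
    using \<theta>2 by (intro binary_component_eqI)
      (simp_all add: \<mu>_2_lookup lookup_single ops_bilinear del: insert_iff)
  have 4: "(\<lambda>r\<in>{1..n+1}. \<lambda>as\<in>tuples (n + 1) A.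
        hi (\<mu> (n + 1) r (map (Poly_Mapping.single 0) as))) = \<sigma>"
  proof (intro ext)
    fix r as
    consider "r \<notin> {1..n+1}" | "r \<in> {1..n+1}" "as \<notin> tuples (n + 1) A"
      | "r \<in> {1..n+1}" "as \<in> tuples (n + 1) A"
      by blast
    then show "(\<lambda>r\<in>{1..n+1}. \<lambda>as\<in>tuples (n + 1) A.
        hi (\<mu> (n + 1) r (map (Poly_Mapping.single 0) as))) r as = \<sigma> r as"
    proof cases
      case 1
      then show ?thesis
        using PiE_arb[OF \<sigma>[unfolded dend_cochains_def], of r]
        by (simp del: atLeastAtMost_iff)
    next
      case 2
      then have "\<sigma> r \<in> tuples (n + 1) A \<rightarrow>\<^sub>E M"
        using \<sigma>_multilinear by (simp add: multilinear_maps_def)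
      then show ?thesis
        using 2 PiE_arb[of "\<sigma> r" _ _ as] by simp
    next
      case 3
      then have "map (Poly_Mapping.single 0) as \<in> tuples (n + 1) (direct_sum V)"
        by (auto simp: tuples_def)
      then show ?thesis
        using 3 \<mu>_Suc_n[of r] by (simp add: comp_def)
    qed
  qed
  show ?thesis
    using 1 2 3 4 by (simp add: dend_inf_to_cocycle_def Let_def flip: d)
qed

section \<open>The identities satisfied by the rebuilt operations\<close>

text \<open>
  The value of the \<open>i\<close>-ary operation that is inserted at position \<open>l\<close> of a \<open>j\<close>-ary one in a
  summand of \<^const>\<open>dend_inf_sum\<close>, and the value of that summand without its sign.
\<close>

definition inner :: "nat \<Rightarrow> nat \<Rightarrow> nat \<Rightarrow> nat \<Rightarrow> (int \<Rightarrow>\<^sub>0 'v) list \<Rightarrow> (int \<Rightarrow>\<^sub>0 'v)" where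
  "inner i j l r xs =
     extend_label (scale_sum scale) i (R j i l r) (\<lambda>t. \<mu> i t (take i (drop (l - 1) xs)))"

definition composite :: "nat \<Rightarrow> nat \<Rightarrow> nat \<Rightarrow> nat \<Rightarrow> (int \<Rightarrow>\<^sub>0 'v) list \<Rightarrow> (int \<Rightarrow>\<^sub>0 'v)" where
  "composite i j l r xs =
     \<mu> j (R0 j i l r) (take (l - 1) xs @ [inner i j l r xs] @ drop (l - 1 + i) xs)"

lemma inner_mem:
  assumes "1 \<le> i" "1 \<le> l" "l - 1 + i \<le> N" "xs \<in> tuples N (direct_sum V)"
  shows "inner i j l r xs \<in> direct_sum V"
  unfolding inner_def
proof (rule direct_sum_extend_label)
  show "\<mu> i t (take i (drop (l - 1) xs)) \<in> direct_sum V" if "t \<in> {1..i}" for t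
    using assms that by (intro \<mu>_mem tuples_take_drop) auto
qed

lemma composite_args:
  assumes "1 \<le> i" "1 \<le> l" "l \<le> j" "i + j = N + 1" "xs \<in> tuples N (direct_sum V)"
  shows "take (l - 1) xs @ [inner i j l r xs] @ drop (l - 1 + i) xs \<in> tuples j (direct_sum V)"
proof -
  have "l - 1 + i \<le> N" using assms by simp
  then have "inner i j l r xs \<in> direct_sum V"
    using assms inner_mem by blast
  then show ?thesis
    using assms by (auto simp: tuples_def dest!: in_set_takeD in_set_dropD)
qed

text \<open>
  Besides the composites that contain an operation which is zero, that of the \<open>(n + 1)\<close>-ary
  operation with itself vanishes, since the outer operation only sees components of degree \<open>0\<close>.
\<close>

lemma composite_zero:
  assumes ij: "1 \<le> i" "1 \<le> l" "l \<le> j" "i + j = N + 1"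
    and xs: "xs \<in> tuples N (direct_sum V)" and r: "r \<in> {1..N}"
    and not: "(i, j) \<notin> {(2, 2), (2, n + 1), (n + 1, 2)}"
  shows "composite i j l r xs = 0"
proof -
  let ?args = "take (l - 1) xs @ [inner i j l r xs] @ drop (l - 1 + i) xs"
  have args: "?args \<in> tuples j (direct_sum V)"
    using ij xs by (rule composite_args)
  have R0: "R0 j i l r \<in> {1..j}"
    using ij r by (intro R0_mem) auto
  have inputs: "take i (drop (l - 1) xs) \<in> tuples i (direct_sum V)"
    using ij xs by (intro tuples_take_drop) auto
  consider "j \<noteq> 2" "j \<noteq> n + 1" | "i \<noteq> 2" "i \<noteq> n + 1" | "i = n + 1" "j = n + 1"
    using not by auto
  then show ?thesis
  proof cases
    case 1
    then show ?thesis
      unfolding composite_def using R0 args by (intro \<mu>_other)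
  next
    case 2
    have "inner i j l r xs = 0"
      using \<mu>_other[OF 2 _ inputs] by (simp add: inner_def extend_label_def)
    then have "0 \<in> set ?args" by simp
    moreover have "1 \<le> j" using ij by simp
    ultimately show ?thesis
      unfolding composite_def
      using multilinear_maps_zero[OF \<mu>_multilinear[OF _ R0] args] by blast
  next
    case 3
    have "lo (inner i j l r xs) = 0"
      unfolding inner_def lookup_extend_label
    proof (rule extend_label_zero)
      show "lo (\<mu> i t (take i (drop (l - 1) xs))) = 0" if "t \<in> {1..i}" for t
        using \<mu>_Suc_n[of t "take i (drop (l - 1) xs)"] that inputs 3 by (simp add: lookup_single)
    qed
    then have "0 \<in> set (map lo ?args)" by simp
    then have "\<sigma> (R0 j i l r) (map lo ?args) = 0"
      using R0 map_lo_tuples[OF args] 3 by (intro \<sigma>_zero) simp_all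
    then show ?thesis
      unfolding composite_def using \<mu>_Suc_n[of "R0 j i l r" ?args] R0 args 3 by simp
  qed
qed

lemma dend_inf_sum_eq:
  assumes xs: "xs \<in> tuples N (direct_sum V)" and r: "r \<in> {1..N}"
  shows "dend_inf_sum scale \<mu> r ds xs =
     (\<Sum>(i, j) \<in> {(i, j). i + j = N + 1} \<inter> {(2, 2), (2, n + 1), (n + 1, 2)}. \<Sum>l=1..j.
        scale_sum scale ((- 1) powi (int l * (int i + 1) + int i * sum_list (take (l - 1) ds)))
          (composite i j l r xs))"
proof -
  have len: "length xs = N" using xs by (simp add: tuples_def)
  let ?S = "{(i, j). 1 \<le> i \<and> 1 \<le> j \<and> i + j = N + 1}"
  have "?S \<subseteq> {..N + 1} \<times> {..N + 1}" by auto
  then have fin: "finite ?S" by (rule finite_subset) simp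
  show ?thesis
    unfolding dend_inf_sum_def len inner_def[symmetric] composite_def[symmetric]
  proof (rule sum.mono_neutral_right)
    show "{(i, j). i + j = N + 1} \<inter> {(2, 2), (2, n + 1), (n + 1, 2)} \<subseteq> ?S"
      by auto
    show "\<forall>ij\<in>?S - {(i, j). i + j = N + 1} \<inter> {(2, 2), (2, n + 1), (n + 1, 2)}.
      (case ij of (i, j) \<Rightarrow> \<Sum>l=1..j.
        scale_sum scale ((- 1) powi (int l * (int i + 1) + int i * sum_list (take (l - 1) ds)))
          (composite i j l r xs)) = 0"
    proof (clarify, rule sum.neutral, rule ballI)
      fix i j l
      assume "1 \<le> i" "1 \<le> j" "i + j = N + 1" "l \<in> {1..j}"
        "(i, j) \<notin> {(i, j). i + j = N + 1} \<inter> {(2, 2), (2, n + 1), (n + 1, 2)}"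
      then have "composite i j l r xs = 0"
        using xs r by (intro composite_zero) auto
      then show "scale_sum scale
          ((- 1) powi (int l * (int i + 1) + int i * sum_list (take (l - 1) ds)))
          (composite i j l r xs) = 0"
        by simp
    qed
  qed (rule fin)
qed

lemma dend_inf_sum_other:
  assumes "xs \<in> tuples N (direct_sum V)" "r \<in> {1..N}" "N \<noteq> 3" "N \<noteq> n + 2"
  shows "dend_inf_sum scale \<mu> r ds xs = 0"
proof -
  have "{(i, j). i + j = N + 1} \<inter> {(2, 2), (2, n + 1), (n + 1, 2)} = {}"
    using assms(3,4) by auto
  then show ?thesis
    by (simp add: dend_inf_sum_eq[OF assms(1,2)])
qed

lemma dend_inf_sum_3:
  assumes r: "r \<in> {1..3}" and V: "x \<in> direct_sum V" "y \<in> direct_sum V" "z \<in> direct_sum V"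
  shows "dend_inf_sum scale \<mu> r ds [x, y, z] =
     Poly_Mapping.single 0 (dend_defect scale \<pi> \<pi> \<pi> \<pi> r (lo x) (lo y) (lo z))
     + Poly_Mapping.single d
       (dend_defect scale \<pi> \<theta>1 \<theta>1 \<theta>1 r (lo x) (lo y) (hi z)
        + dend_defect scale \<theta>1 \<theta>2 \<theta>2 \<theta>1 r (lo x) (hi y) (lo z)
        + dend_defect scale \<theta>2 \<theta>2 \<pi> \<theta>2 r (hi x) (lo y) (lo z))"
proof -
  let ?v = "inner 2 2 1 r [x, y, z]" and ?w = "inner 2 2 2 r [x, y, z]"
  have xs: "[x, y, z] \<in> tuples 3 (direct_sum V)"
    using V by (simp add: tuples_def)
  have pairs: "{(i, j). i + j = 3 + 1} \<inter> {(2, 2), (2, n + 1), (n + 1, 2)} = {(2, 2::nat)}"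
    using n by auto
  have labels: "{1..2::nat} = {1, 2}" by auto
  have R0: "R0 2 2 1 r \<in> {1, 2}" "R0 2 2 2 r \<in> {1, 2}"
    using R0_mem[of 2 1 2 r] R0_mem[of 2 2 2 r] r unfolding labels by auto
  have vw: "?v \<in> direct_sum V" "?w \<in> direct_sum V"
    using xs by (auto intro!: inner_mem[of _ _ 3])
  note mem = V[THEN lo_mem] V[THEN hi_mem] vw[THEN lo_mem] vw[THEN hi_mem]
  have v: "lo ?v = extend_label scale 2 (R 2 2 1 r) (\<lambda>t. \<pi> t (lo x) (lo y))"
    "hi ?v = extend_label scale 2 (R 2 2 1 r) (\<lambda>t. \<theta>1 t (lo x) (hi y))
      + extend_label scale 2 (R 2 2 1 r) (\<lambda>t. \<theta>2 t (hi x) (lo y))"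
    unfolding inner_def lookup_extend_label extend_label_add[symmetric]
    by (simp_all add: extend_label_2 \<mu>_2_lookup V)
  have w: "lo ?w = extend_label scale 2 (R 2 2 2 r) (\<lambda>t. \<pi> t (lo y) (lo z))"
    "hi ?w = extend_label scale 2 (R 2 2 2 r) (\<lambda>t. \<theta>1 t (lo y) (hi z))
      + extend_label scale 2 (R 2 2 2 r) (\<lambda>t. \<theta>2 t (hi y) (lo z))"
    unfolding inner_def lookup_extend_label extend_label_add[symmetric]
    by (simp_all add: extend_label_2 \<mu>_2_lookup V)
  have parts: "extend_label scale 2 u (\<lambda>t. \<theta>1 t a m) \<in> M" "extend_label scale 2 u (\<lambda>t. \<theta>2 t m a) \<in> M"
    if "a \<in> A" "m \<in> M" for u a m
    using that by (simp_all add: extend_label_2 ops_bilinear subspace_M subspace_add subspace_scale)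
  have "dend_inf_sum scale \<mu> r ds [x, y, z] =
      composite 2 2 2 r [x, y, z] - composite 2 2 1 r [x, y, z]"
    unfolding dend_inf_sum_eq[OF xs r] pairs
    by (simp add: sum_1_2 minus_one_powi del: One_nat_def)
      (rule poly_mapping_eqI, simp add: lookup_add lookup_minus)
  also have "composite 2 2 1 r [x, y, z] = \<mu> 2 (R0 2 2 1 r) [?v, z]"
    by (simp add: composite_def)
  also have "\<dots> = Poly_Mapping.single 0 (\<pi> (R0 2 2 1 r) (lo ?v) (lo z))
      + Poly_Mapping.single d (\<theta>1 (R0 2 2 1 r) (lo ?v) (hi z) + \<theta>2 (R0 2 2 1 r) (hi ?v) (lo z))"
    by (rule \<mu>_2[OF R0(1) vw(1) V(3)])
  also have "\<theta>2 (R0 2 2 1 r) (hi ?v) (lo z) =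
      \<theta>2 (R0 2 2 1 r) (extend_label scale 2 (R 2 2 1 r) (\<lambda>t. \<theta>1 t (lo x) (hi y))) (lo z)
      + \<theta>2 (R0 2 2 1 r) (extend_label scale 2 (R 2 2 1 r) (\<lambda>t. \<theta>2 t (hi x) (lo y))) (lo z)"
    unfolding v using mem by (intro ops_bilinear R0 parts)
  also have "composite 2 2 2 r [x, y, z] = \<mu> 2 (R0 2 2 2 r) [x, ?w]"
    by (simp add: composite_def)
  also have "\<dots> = Poly_Mapping.single 0 (\<pi> (R0 2 2 2 r) (lo x) (lo ?w))
      + Poly_Mapping.single d (\<theta>1 (R0 2 2 2 r) (lo x) (hi ?w) + \<theta>2 (R0 2 2 2 r) (hi x) (lo ?w))"
    by (rule \<mu>_2[OF R0(2) V(1) vw(2)])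
  also have "\<theta>1 (R0 2 2 2 r) (lo x) (hi ?w) =
      \<theta>1 (R0 2 2 2 r) (lo x) (extend_label scale 2 (R 2 2 2 r) (\<lambda>t. \<theta>1 t (lo y) (hi z)))
      + \<theta>1 (R0 2 2 2 r) (lo x) (extend_label scale 2 (R 2 2 2 r) (\<lambda>t. \<theta>2 t (hi y) (lo z)))"
    unfolding w using mem by (intro ops_bilinear R0 parts)
  finally show ?thesis
    unfolding v(1) w(1) dend_defect_def by (simp add: single_add single_diff)
qed

text \<open>
  The homogeneous inputs may have any degrees \<open>ds\<close>: these enter the sum only through signs.
\<close>

lemma dend_inf_sum_Suc_Suc_n:
  assumes r: "r \<in> {1..n+2}" and len: "length xs = n + 2" and hom: "homogeneous_tuple V ds xs"
  shows "dend_inf_sum scale \<mu> r ds xs =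
    Poly_Mapping.single d (dend_coboundary scale \<pi> \<theta>1 \<theta>2 (n + 1) \<sigma> r (map lo xs))"
proof -
  define k where "k = n + 1"
  define as where "as = map lo xs"
  have xs: "xs \<in> tuples (n + 2) (direct_sum V)"
    using homogeneous_tuple_mem[OF hom] len by simp
  have pairs: "{(i, j). i + j = n + 2 + 1} \<inter> {(2, 2), (2, n + 1), (n + 1, 2)} = {(2, k), (k, 2)}"
    and k: "k \<noteq> 2" and k_less: "k < n + 2"
    using n by (auto simp: k_def)
  have labels: "{1..2::nat} = {1, 2}" by auto
  have nth: "xs ! p \<in> direct_sum V" "lo (xs ! p) \<in> A" "hi (xs ! p) \<in> M" "as ! p = lo (xs ! p)"
    if "p < n + 2" for p
    using tuples_nth[OF xs that] len that by (auto simp: lo_mem hi_mem as_def)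
  have \<mu>_k: "\<mu> k t ys = Poly_Mapping.single d (\<sigma> t (map lo ys))"
    if "t \<in> {1..k}" "ys \<in> tuples k (direct_sum V)" for t ys
    using \<mu>_Suc_n that by (simp add: k_def)
  have "dend_inf_sum scale \<mu> r ds xs =
      (\<Sum>l=1..k. scale_sum scale ((- 1) powi (int l * (int 2 + 1) + int 2 * sum_list (take (l - 1) ds)))
          (composite 2 k l r xs))
      + (\<Sum>l=1..2. scale_sum scale ((- 1) powi (int l * (int k + 1) + int k * sum_list (take (l - 1) ds)))
          (composite k 2 l r xs))"
    unfolding dend_inf_sum_eq[OF xs r] pairs using k by simp
  also have "(\<Sum>l=1..k. scale_sum scale ((- 1) powi (int l * (int 2 + 1) + int 2 * sum_list (take (l - 1) ds)))
          (composite 2 k l r xs)) = Poly_Mapping.single d (\<Sum>l=1..k. scale ((- 1) ^ l)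
          (\<sigma> (R0 k 2 l r) (take (l - 1) as
            @ [extend_label scale 2 (R k 2 l r) (\<lambda>t. \<pi> t (as ! (l - 1)) (as ! l))] @ drop (l + 1) as)))"
    (is "?L = Poly_Mapping.single d (\<Sum>l=1..k. scale ((- 1) ^ l) (?f l))")
  proof -
    have "scale_sum scale ((- 1) powi (int l * (int 2 + 1) + int 2 * sum_list (take (l - 1) ds)))
        (composite 2 k l r xs) = Poly_Mapping.single d (scale ((- 1) ^ l) (?f l))"
      if l: "l \<in> {1..k}" for l
    proof -
      \<comment> \<open>The exponent has the parity of \<open>l\<close>, whatever the degrees.\<close>
      have "(- 1 :: 'k) powi (int l * (int 2 + 1) + int 2 * sum_list (take (l - 1) ds)) = (- 1) ^ l"
        by (simp add: minus_one_powi uminus_power_if)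
      moreover have "composite 2 k l r xs = Poly_Mapping.single d (?f l)"
      proof -
        have "lo (inner 2 k l r xs) =
            extend_label scale 2 (R k 2 l r) (\<lambda>t. \<pi> t (as ! (l - 1)) (as ! l))"
          unfolding inner_def lookup_extend_label
        proof (rule extend_label_cong)
          fix t :: nat assume "t \<in> {1..2}"
          then have t: "t \<in> {1, 2}" by auto
          have l': "l - 1 < n + 2" "l < n + 2"
            using l by (auto simp: k_def)
          have "take 2 (drop (l - 1) xs) = [xs ! (l - 1), xs ! l]"
            using take_2_drop[of "l - 1" xs] l len by (auto simp: k_def)
          then show "lo (\<mu> 2 t (take 2 (drop (l - 1) xs))) = \<pi> t (as ! (l - 1)) (as ! l)"
            using \<mu>_2_lookup(1)[OF t nth(1)[OF l'(1)] nth(1)[OF l'(2)]]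
              nth(4)[OF l'(1)] nth(4)[OF l'(2)] by simp
        qed
        moreover have "take (l - 1) xs @ [inner 2 k l r xs] @ drop (l - 1 + 2) xs
            \<in> tuples k (direct_sum V)"
          using l by (intro composite_args[OF _ _ _ _ xs]) (auto simp: k_def)
        moreover have "R0 k 2 l r \<in> {1..k}"
          using l r by (intro R0_mem) (auto simp: k_def)
        moreover have "l - 1 + 2 = l + 1" using l by simp
        ultimately show ?thesis
          unfolding composite_def by (simp add: \<mu>_k as_def take_map drop_map del: atLeastAtMost_iff)
      qed
      ultimately show ?thesis by (simp add: scale_sum_single)
    qed
    then have "?L = (\<Sum>l=1..k. Poly_Mapping.single d (scale ((- 1) ^ l) (?f l)))"
      by (intro sum.cong refl)
    also have "\<dots> = Poly_Mapping.single d (\<Sum>l=1..k. scale ((- 1) ^ l) (?f l))"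
      by (rule poly_mapping_eqI) (simp add: lookup_sum lookup_single when_def)
    finally show ?thesis .
  qed
  also have "(\<Sum>l=1..2. scale_sum scale ((- 1) powi (int l * (int k + 1) + int k * sum_list (take (l - 1) ds)))
          (composite k 2 l r xs)) =
      Poly_Mapping.single d (scale ((- 1) ^ (k + 1))
         (\<theta>2 (R0 2 k 1 r) (extend_label scale k (R 2 k 1 r) (\<lambda>t. \<sigma> t (take k as))) (as ! k)))
      + Poly_Mapping.single d
         (\<theta>1 (R0 2 k 2 r) (as ! 0) (extend_label scale k (R 2 k 2 r) (\<lambda>t. \<sigma> t (drop 1 as))))"
  proof -
    let ?v = "inner k 2 1 r xs" and ?w = "inner k 2 2 r xs"
    have vw: "?v \<in> direct_sum V" "?w \<in> direct_sum V"
      using xs by (auto intro!: inner_mem[of _ _ "n + 2"] simp: k_def)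
    have R0: "R0 2 k 1 r \<in> {1, 2}" "R0 2 k 2 r \<in> {1, 2}"
      using R0_mem[of k 1 2 r] R0_mem[of k 2 2 r] r unfolding labels by (auto simp: k_def)
    have inputs: "take k xs \<in> tuples k (direct_sum V)" "drop (Suc 0) xs \<in> tuples k (direct_sum V)"
      "take k (drop (Suc 0) xs) = drop (Suc 0) xs"
      using tuples_take_drop[OF xs, of 0 k] tuples_take_drop[OF xs, of 1 k] len
      by (auto simp: k_def)
    have v: "lo ?v = 0" "hi ?v = extend_label scale k (R 2 k 1 r) (\<lambda>t. \<sigma> t (take k as))"
      unfolding inner_def lookup_extend_label
      by (auto intro!: extend_label_zero extend_label_cong
          simp: \<mu>_k inputs lookup_single as_def take_map simp del: One_nat_def)
    have w: "lo ?w = 0" "hi ?w = extend_label scale k (R 2 k 2 r) (\<lambda>t. \<sigma> t (drop 1 as))"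
      unfolding inner_def lookup_extend_label
      by (auto intro!: extend_label_zero extend_label_cong
          simp: \<mu>_k inputs lookup_single as_def drop_map)
    have "take (1 - 1) xs @ [?v] @ drop (1 - 1 + k) xs = [?v, xs ! k]"
      using len Cons_nth_drop_Suc[of k xs] by (simp add: k_def)
    then have "composite k 2 1 r xs = \<mu> 2 (R0 2 k 1 r) [?v, xs ! k]"
      unfolding composite_def by simp
    also have "\<dots> = Poly_Mapping.single d (\<theta>2 (R0 2 k 1 r) (hi ?v) (as ! k))"
      using nth[of k] vw(1)[THEN hi_mem] k_less
      by (simp add: \<mu>_2[OF R0(1) vw(1)] v(1) ops_bilinear[OF R0(1)] del: One_nat_def)
    finally have 1: "composite k 2 1 r xs = \<dots>" .
    have "take (2 - 1) xs @ [?w] @ drop (2 - 1 + k) xs = [xs ! 0, ?w]"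
      using len by (simp add: k_def take_Suc_conv_app_nth)
    then have "composite k 2 2 r xs = \<mu> 2 (R0 2 k 2 r) [xs ! 0, ?w]"
      unfolding composite_def by simp
    also have "\<dots> = Poly_Mapping.single d (\<theta>1 (R0 2 k 2 r) (as ! 0) (hi ?w))"
      using nth[of 0] vw(2)[THEN hi_mem]
      by (simp add: \<mu>_2[OF R0(2) _ vw(2)] w(1) ops_bilinear[OF R0(2)])
    finally have 2: "composite k 2 2 r xs = \<dots>" .
    have ds: "length ds = n + 2"
      using hom len by (simp add: homogeneous_tuple_def list_all2_conv_all_nth)
    \<comment> \<open>The degree of the first input enters this sign, but only its component of degree \<open>0\<close>
        enters the value: either the degree is \<open>0\<close> or the value is.\<close>
    have "scale_sum scale ((- 1) powi (int 2 * (int k + 1) + int k * sum_list (take (2 - 1) ds)))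
        (composite k 2 2 r xs) = composite k 2 2 r xs"
    proof (cases "ds ! 0 = 0")
      case True
      moreover have "take 1 ds = [ds ! 0]"
        using ds by (simp add: take_Suc_conv_app_nth)
      ultimately show ?thesis
        by (simp add: minus_one_powi 2 scale_sum_single)
    next
      case False
      then have "as ! 0 = 0"
        using homogeneous_nth_lo[OF hom, of 0] nth[of 0] len by simp
      then show ?thesis
        using vw(2)[THEN hi_mem] by (simp add: 2 ops_bilinear[OF R0(2)])
    qed
    moreover have "scale_sum scale ((- 1) powi (int 1 * (int k + 1) + int k * sum_list (take (1 - 1) ds)))
        (composite k 2 1 r xs) = scale_sum scale ((- 1) ^ (k + 1)) (composite k 2 1 r xs)"
      by (simp add: minus_one_powi uminus_power_if)
    ultimately show ?thesis
      unfolding sum_1_2 using 1 2 v(2) w(2) by (simp add: scale_sum_single)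
  qed
  finally show ?thesis
    unfolding dend_coboundary_def as_def[symmetric] k_def[symmetric]
    by (simp only: single_add ac_simps)
qed

text \<open>
  A defect vanishes if its argument from \<open>M\<close> does. This separates the three summands in the
  component of degree \<open>d\<close> of the ternary identity: for inputs of which exactly one has degree \<open>d\<close>,
  only one summand is left.
\<close>

lemma dend_defect_zero:
  assumes r: "r \<in> {1..3}" and a: "a \<in> A" and b: "b \<in> A"
  shows "dend_defect scale \<pi> \<theta>1 \<theta>1 \<theta>1 r a b 0 = 0"
    and "dend_defect scale \<theta>1 \<theta>2 \<theta>2 \<theta>1 r a 0 b = 0"
    and "dend_defect scale \<theta>2 \<theta>2 \<pi> \<theta>2 r 0 a b = 0"
proof -
  have R0: "R0 2 2 1 r \<in> {1, 2}" "R0 2 2 2 r \<in> {1, 2}"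
    using R0_mem[of 2 1 2 r] R0_mem[of 2 2 2 r] r by auto
  have zero: "extend_label scale 2 u (\<lambda>t. \<theta>1 t a 0) = 0" "extend_label scale 2 u (\<lambda>t. \<theta>2 t 0 a) = 0"
    if "a \<in> A" for u a
    using that by (simp_all add: extend_label_2 ops_bilinear)
  have \<pi>_mem: "extend_label scale 2 u (\<lambda>t. \<pi> t a b) \<in> A" for u
    using a b by (simp add: extend_label_2 ops_bilinear subspace_A subspace_add subspace_scale)
  show "dend_defect scale \<pi> \<theta>1 \<theta>1 \<theta>1 r a b 0 = 0"
    "dend_defect scale \<theta>1 \<theta>2 \<theta>2 \<theta>1 r a 0 b = 0"
    "dend_defect scale \<theta>2 \<theta>2 \<pi> \<theta>2 r 0 a b = 0"
    unfolding dend_defect_def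
    by (simp_all add: a b zero \<pi>_mem ops_bilinear[OF R0(1)] ops_bilinear[OF R0(2)] del: One_nat_def)
qed

lemma ternary_identities:
  "(\<forall>r\<in>{1..3}. \<forall>ds xs. length xs = 3 \<and> homogeneous_tuple V ds xs \<longrightarrow>
      dend_inf_sum scale \<mu> r ds xs = 0) \<longleftrightarrow>
   dend_identities \<pi> \<pi> \<pi> \<pi> A A A \<and> dend_identities \<theta>2 \<theta>2 \<pi> \<theta>2 M A A \<and>
   dend_identities \<theta>1 \<theta>2 \<theta>2 \<theta>1 A M A \<and> dend_identities \<pi> \<theta>1 \<theta>1 \<theta>1 A A M"
  (is "?inf \<longleftrightarrow> ?id")
proof
  assume ?inf
  have eq: "Poly_Mapping.single 0 (dend_defect scale \<pi> \<pi> \<pi> \<pi> r (lo x) (lo y) (lo z))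
     + Poly_Mapping.single d
       (dend_defect scale \<pi> \<theta>1 \<theta>1 \<theta>1 r (lo x) (lo y) (hi z)
        + dend_defect scale \<theta>1 \<theta>2 \<theta>2 \<theta>1 r (lo x) (hi y) (lo z)
        + dend_defect scale \<theta>2 \<theta>2 \<pi> \<theta>2 r (hi x) (lo y) (lo z)) = 0"
    if r: "r \<in> {1..3}" and x: "x \<in> homogeneous V p" and y: "y \<in> homogeneous V q"
      and z: "z \<in> homogeneous V s" for r x y z p q s
  proof -
    have hom: "homogeneous_tuple V [p, q, s] [x, y, z]"
      using x y z by (simp add: homogeneous_tuple_def)
    then have "dend_inf_sum scale \<mu> r [p, q, s] [x, y, z] = 0"
      using \<open>?inf\<close> r by simp
    moreover have "x \<in> direct_sum V" "y \<in> direct_sum V" "z \<in> direct_sum V"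
      using homogeneous_tuple_mem[OF hom] by (simp_all add: tuples_def)
    ultimately show ?thesis
      using dend_inf_sum_3[OF r] by simp
  qed
  have lookups: "u = 0" "w = 0"
    if "Poly_Mapping.single 0 u + Poly_Mapping.single d w = 0" for u w :: 'v
    using arg_cong[OF that, of lo] arg_cong[OF that, of hi]
    by (simp_all add: lookup_add lookup_single)
  have hom: "a \<in> A \<Longrightarrow> Poly_Mapping.single 0 a \<in> homogeneous V 0"
    "m \<in> M \<Longrightarrow> Poly_Mapping.single d m \<in> homogeneous V d" for a m
    by (auto simp: homogeneous_def)
  show ?id
    unfolding dend_identities_iff_defect
  proof (intro conjI ballI)
    fix r :: nat and a b c assume r: "r \<in> {1..3}"
    note zero = dend_defect_zero[OF r] lookup_single
    show "dend_defect scale \<pi> \<pi> \<pi> \<pi> r a b c = 0" if "a \<in> A" "b \<in> A" "c \<in> A"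
      using lookups(1)[OF eq[OF r hom(1)[OF that(1)] hom(1)[OF that(2)] hom(1)[OF that(3)]]]
      by simp
    show "dend_defect scale \<theta>2 \<theta>2 \<pi> \<theta>2 r a b c = 0" if "a \<in> M" "b \<in> A" "c \<in> A"
      using lookups(2)[OF eq[OF r hom(2)[OF that(1)] hom(1)[OF that(2)] hom(1)[OF that(3)]]] that
      by (simp add: zero)
    show "dend_defect scale \<theta>1 \<theta>2 \<theta>2 \<theta>1 r a b c = 0" if "a \<in> A" "b \<in> M" "c \<in> A"
      using lookups(2)[OF eq[OF r hom(1)[OF that(1)] hom(2)[OF that(2)] hom(1)[OF that(3)]]] that
      by (simp add: zero)
    show "dend_defect scale \<pi> \<theta>1 \<theta>1 \<theta>1 r a b c = 0" if "a \<in> A" "b \<in> A" "c \<in> M"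
      using lookups(2)[OF eq[OF r hom(1)[OF that(1)] hom(1)[OF that(2)] hom(2)[OF that(3)]]] that
      by (simp add: zero)
  qed
next
  assume id: ?id
  show ?inf
  proof (intro ballI allI impI)
    fix r :: nat and ds xs
    assume r: "r \<in> {1..3}" and *: "length xs = 3 \<and> homogeneous_tuple V ds xs"
    then have xs: "xs \<in> tuples 3 (direct_sum V)"
      using homogeneous_tuple_mem by metis
    then obtain x y z where xyz: "xs = [x, y, z]"
      by (auto simp: tuples_def numeral_3_eq_3 length_Suc_conv)
    have V: "x \<in> direct_sum V" "y \<in> direct_sum V" "z \<in> direct_sum V"
      using xs by (simp_all add: xyz tuples_def)
    show "dend_inf_sum scale \<mu> r ds xs = 0"
      using id r V[THEN lo_mem] V[THEN hi_mem] unfolding dend_identities_iff_defect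
      by (simp add: xyz dend_inf_sum_3[OF r V])
  qed
qed

lemma cocycle_identities:
  "(\<forall>r\<in>{1..n+2}. \<forall>ds xs. length xs = n + 2 \<and> homogeneous_tuple V ds xs \<longrightarrow>
      dend_inf_sum scale \<mu> r ds xs = 0) \<longleftrightarrow> dend_cocycle scale A \<pi> M \<theta>1 \<theta>2 (n + 1) \<sigma>"
  (is "?inf \<longleftrightarrow> ?coc")
proof
  assume ?inf
  have "dend_coboundary scale \<pi> \<theta>1 \<theta>2 (n + 1) \<sigma> r as = 0"
    if r: "r \<in> {1..n+2}" and as: "as \<in> tuples (n + 2) A" for r as
  proof -
    let ?xs = "map (Poly_Mapping.single 0) as" and ?ds = "replicate (length as) (0::int)"
    have len: "length ?xs = n + 2" using as by (simp add: tuples_def)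
    have hom: "homogeneous_tuple V ?ds ?xs"
    proof -
      have "set as \<subseteq> A" using as by (simp add: tuples_def)
      then show ?thesis
        by (induction as) (simp_all add: homogeneous_tuple_def homogeneous_def)
    qed
    have "dend_inf_sum scale \<mu> r ?ds ?xs = 0"
      using \<open>?inf\<close> r len hom by blast
    then have "hi (Poly_Mapping.single d
        (dend_coboundary scale \<pi> \<theta>1 \<theta>2 (n + 1) \<sigma> r (map lo ?xs))) = 0"
      using dend_inf_sum_Suc_Suc_n[OF r len hom] by simp
    then show ?thesis by (simp add: comp_def)
  qed
  then show ?coc
    using \<sigma> by (simp add: dend_cocycle_def)
next
  assume ?coc
  show ?inf
  proof (intro ballI allI impI)
    fix r :: nat and ds xs
    assume r: "r \<in> {1..n+2}" and "length xs = n + 2 \<and> homogeneous_tuple V ds xs"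
    then have *: "length xs = n + 2" "homogeneous_tuple V ds xs" by auto
    then have "map lo xs \<in> tuples (n + 2) A"
      using homogeneous_tuple_mem map_lo_tuples by metis
    then show "dend_inf_sum scale \<mu> r ds xs = 0"
      using \<open>?coc\<close> r dend_inf_sum_Suc_Suc_n[OF r *] by (simp add: dend_cocycle_def)
  qed
qed

lemma dend_inf_algebra_iff:
  "dend_inf_algebra scale V \<mu> \<longleftrightarrow>
     dendriform_algebra scale A \<pi> \<and> dend_representation scale A \<pi> M \<theta>1 \<theta>2 \<and>
     dend_cocycle scale A \<pi> M \<theta>1 \<theta>2 (n + 1) \<sigma>"
proof -
  define I where "I N \<longleftrightarrow> (\<forall>r\<in>{1..N}. \<forall>ds xs. length xs = N \<and> homogeneous_tuple V ds xs \<longrightarrow>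
      dend_inf_sum scale \<mu> r ds xs = 0)" for N
  have other: "I N" if "N \<noteq> 3" "N \<noteq> n + 2" for N
    unfolding I_def
  proof (intro ballI allI impI)
    fix r ds xs
    assume "r \<in> {1..N}" "length xs = N \<and> homogeneous_tuple V ds xs"
    then show "dend_inf_sum scale \<mu> r ds xs = 0"
      using dend_inf_sum_other[OF _ _ that] homogeneous_tuple_mem by metis
  qed
  have graded: "\<forall>i. subspace (V i)"
    "\<forall>k\<ge>1. \<forall>r\<in>{1..k}. \<forall>ds xs. length xs = k \<and> homogeneous_tuple V ds xs \<longrightarrow>
      \<mu> k r xs \<in> homogeneous V (sum_list ds + int k - 2)"
    by (simp add: subspace_V) (intro allI impI ballI \<mu>_homogeneous; elim conjE; assumption)
  have "dend_inf_algebra scale V \<mu> \<longleftrightarrow> (\<forall>N\<ge>1. I N)"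
    unfolding dend_inf_algebra_def I_def using graded \<mu>_PiE
    by - (rule iffI, elim conjE, assumption, intro conjI, assumption+)
  also have "\<dots> \<longleftrightarrow> I 3 \<and> I (n + 2)"
    using other by (metis le_add2 le_trans one_le_numeral)
  also have "I 3 \<longleftrightarrow> dend_identities \<pi> \<pi> \<pi> \<pi> A A A \<and> dend_identities \<theta>2 \<theta>2 \<pi> \<theta>2 M A A \<and>
      dend_identities \<theta>1 \<theta>2 \<theta>2 \<theta>1 A M A \<and> dend_identities \<pi> \<theta>1 \<theta>1 \<theta>1 A A M"
    unfolding I_def by (rule ternary_identities)
  also have "I (n + 2) \<longleftrightarrow> dend_cocycle scale A \<pi> M \<theta>1 \<theta>2 (n + 1) \<sigma>"
    unfolding I_def by (rule cocycle_identities)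
  finally show ?thesis
    by (simp only: dendriform_algebra_def dend_representation_def subspace_A subspace_M \<pi> \<theta>1 \<theta>2
        simp_thms conj_assoc)
qed

end

section \<open>The components of a two-term algebra\<close>

context vector_space
begin

lemma single_mem_direct_sum:
  "(\<And>i. subspace (A i)) \<Longrightarrow> a \<in> A p \<Longrightarrow> Poly_Mapping.single p a \<in> direct_sum A"
  by (simp add: direct_sum_def lookup_single when_def subspace_0)

lemma binary_component_bilinear:
  assumes A: "\<And>i. subspace (A i)"
    and \<mu>: "\<And>r. r \<in> {1, 2} \<Longrightarrow>
      \<mu> 2 r \<in> multilinear_maps (scale_sum scale) (scale_sum scale) 2 (direct_sum A) (direct_sum A)"
  shows "binary_component A \<mu> p q e \<in> {1, 2} \<rightarrow>\<^sub>E bilinear_maps scale (A p) (A q) (A e)"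
  unfolding binary_component_def
proof (intro restrict_PiE_iff[THEN iffD2] ballI)
  fix r :: nat assume r: "r \<in> {1, 2}"
  let ?f = "\<lambda>x y. Poly_Mapping.lookup (\<mu> 2 r [Poly_Mapping.single p x, Poly_Mapping.single q y]) e"
  note single = single_mem_direct_sum[where A = A, OF A]
  have lin: "linear_on (scale_sum scale) (scale_sum scale) (direct_sum A) (\<lambda>u. \<mu> 2 r ([x, y][i := u]))"
    if "x \<in> direct_sum A" "y \<in> direct_sum A" "i < 2" for x y i
    by (rule multilinear_maps_linear[OF \<mu>[OF r]]) (use that in \<open>simp_all add: tuples_def\<close>)
  have mem: "\<mu> 2 r [x, y] \<in> direct_sum A" if "x \<in> direct_sum A" "y \<in> direct_sum A" for x y
    by (rule multilinear_maps_mem[OF \<mu>[OF r]]) (use that in \<open>simp add: tuples_def\<close>)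
  have left: "linear_on scale scale (A p) (\<lambda>x. ?f x y)" if "y \<in> A q" for y
  proof -
    have "linear_on (scale_sum scale) (scale_sum scale) (direct_sum A)
        (\<lambda>u. \<mu> 2 r [u, Poly_Mapping.single q y])"
      using lin[of "Poly_Mapping.single q y" "Poly_Mapping.single q y" 0] single that by simp
    then show ?thesis
      using single unfolding linear_on_def
      by (simp add: single_add lookup_add flip: scale_sum_single)
  qed
  have right: "linear_on scale scale (A q) (\<lambda>y. ?f x y)" if "x \<in> A p" for x
  proof -
    have "linear_on (scale_sum scale) (scale_sum scale) (direct_sum A)
        (\<lambda>u. \<mu> 2 r [Poly_Mapping.single p x, u])"
      using lin[of "Poly_Mapping.single p x" "Poly_Mapping.single p x" 1] single that by simp
    then show ?thesis
      using single unfolding linear_on_def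
      by (simp add: single_add lookup_add flip: scale_sum_single)
  qed
  define g where "g = (\<lambda>x\<in>A p. \<lambda>y\<in>A q. ?f x y)"
  have g: "g x y = ?f x y" if "x \<in> A p" "y \<in> A q" for x y
    using that by (simp add: g_def)
  have "?f x y \<in> A e" if "x \<in> A p" "y \<in> A q" for x y
    using mem[of "Poly_Mapping.single p x" "Poly_Mapping.single q y"] single that
    by (simp add: direct_sum_def)
  then have "g \<in> A p \<rightarrow>\<^sub>E (A q \<rightarrow>\<^sub>E A e)"
    by (simp add: g_def)
  moreover have "linear_on scale scale (A q) (\<lambda>y. g x y)" if "x \<in> A p" for x
    using right[OF that] that A[of q] unfolding linear_on_def
    by (simp add: g subspace_add subspace_scale)
  moreover have "linear_on scale scale (A p) (\<lambda>x. g x y)" if "y \<in> A q" for y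
    using left[OF that] that A[of p] unfolding linear_on_def
    by (simp add: g subspace_add subspace_scale)
  ultimately show "(\<lambda>x\<in>A p. \<lambda>y\<in>A q. ?f x y) \<in> bilinear_maps scale (A p) (A q) (A e)"
    unfolding g_def[symmetric] by (simp add: bilinear_maps_def)
qed

lemma degree_0_component_multilinear:
  assumes A: "\<And>i. subspace (A i)"
    and f: "\<And>r. r \<in> {1..k} \<Longrightarrow>
      f r \<in> multilinear_maps (scale_sum scale) (scale_sum scale) k (direct_sum A) (direct_sum A)"
  shows "(\<lambda>r\<in>{1..k}. \<lambda>as\<in>tuples k (A 0).
      Poly_Mapping.lookup (f r (map (Poly_Mapping.single 0) as)) e) \<in> dend_cochains scale (A 0) (A e) k"
  unfolding dend_cochains_def
proof (intro restrict_PiE_iff[THEN iffD2] ballI)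
  fix r assume "r \<in> {1..k}"
  note f = f[OF this]
  note single = single_mem_direct_sum[where A = A, OF A]
  let ?g = "\<lambda>as. Poly_Mapping.lookup (f r (map (Poly_Mapping.single 0) as)) e"
  have tup: "map (Poly_Mapping.single 0) as \<in> tuples k (direct_sum A)" if "as \<in> tuples k (A 0)" for as
    using that single by (auto simp: tuples_def)
  have mem: "?g as \<in> A e" if "as \<in> tuples k (A 0)" for as
    using multilinear_maps_mem[OF f tup[OF that]] by (simp add: direct_sum_def)
  have "linear_on scale scale (A 0) (\<lambda>x. (\<lambda>as\<in>tuples k (A 0). ?g as) (as[p := x]))"
    if as: "as \<in> tuples k (A 0)" and p: "p < k" for as p
  proof -
    have "linear_on (scale_sum scale) (scale_sum scale) (direct_sum A)
        (\<lambda>u. f r ((map (Poly_Mapping.single 0) as)[p := u]))"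
      using f tup[OF as] p by (simp add: multilinear_maps_def)
    then have "linear_on scale scale (A 0) (\<lambda>x. ?g (as[p := x]))"
      using single unfolding linear_on_def
      by (simp add: map_update single_add lookup_add flip: scale_sum_single)
    then show ?thesis
      using tuples_update[OF as] A[of 0] unfolding linear_on_def
      by (simp add: subspace_add subspace_scale)
  qed
  then show "(\<lambda>as\<in>tuples k (A 0). ?g as) \<in> multilinear_maps scale scale k (A 0) (A e)"
    using mem by (simp add: multilinear_maps_def)
qed

text \<open>
  The counting of degrees: multilinearity reduces the comparison of \<open>\<mu>\<close> with the operations
  rebuilt from its components to inputs of degrees \<open>0\<close> and \<open>d\<close>, and there both sides have the same
  degree \<open>e\<close>. Unless \<open>e\<close> is \<open>0\<close> or \<open>d\<close>, both vanish; apart from the differential, which is zero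
  by assumption, \<open>e\<close> is \<open>0\<close> or \<open>d\<close> only in the degrees of one of the components.
\<close>

lemma two_term_components:
  fixes A :: "int \<Rightarrow> 'b set"
  assumes n: "n \<ge> 2" and d: "d = int n - 1"
    and A: "\<And>i. subspace (A i)"
    and \<mu>: "\<mu> \<in> (\<Pi>\<^sub>E k\<in>{1..}. \<Pi>\<^sub>E r\<in>{1..k}.
            multilinear_maps (scale_sum scale) (scale_sum scale) k (direct_sum A) (direct_sum A))"
    and degree: "\<And>k r ds xs. k \<ge> 1 \<Longrightarrow> r \<in> {1..k} \<Longrightarrow> length xs = k \<Longrightarrow> homogeneous_tuple A ds xs \<Longrightarrow>
        \<mu> k r xs \<in> homogeneous A (sum_list ds + int k - 2)"
    and two: "two_term d A \<mu>"
    and comp: "dend_inf_to_cocycle n (A, \<mu>) = ((A0, \<pi>), M, \<theta>1, \<theta>2, \<sigma>)"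
  shows "two_term_data scale n d A0 M \<pi> \<theta>1 \<theta>2 \<sigma>"
    and "A = two_term_space d A0 M"
    and "\<mu> = two_term_ops d n A0 M \<pi> \<theta>1 \<theta>2 \<sigma>"
proof -
  have multi: "\<mu> k r \<in> multilinear_maps (scale_sum scale) (scale_sum scale) k (direct_sum A) (direct_sum A)"
    if "k \<ge> 1" "r \<in> {1..k}" for k r
    using \<mu> that by (meson PiE_mem atLeast_iff)
  have eqs: "A0 = A 0" "M = A d" "\<pi> = binary_component A \<mu> 0 0 0"
    "\<theta>1 = binary_component A \<mu> 0 d d" "\<theta>2 = binary_component A \<mu> d 0 d"
    "\<sigma> = (\<lambda>r\<in>{1..n+1}. \<lambda>as\<in>tuples (n + 1) (A 0).
        Poly_Mapping.lookup (\<mu> (n + 1) r (map (Poly_Mapping.single 0) as)) d)"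
    by (insert comp[unfolded dend_inf_to_cocycle_def Let_def d[symmetric] prod.case prod.inject];
        elim conjE; rule sym, assumption)+
  have binary: "binary_component A \<mu> p q e \<in> {1, 2} \<rightarrow>\<^sub>E bilinear_maps scale (A p) (A q) (A e)" for p q e
    using A multi by (intro binary_component_bilinear) auto
  show data: "two_term_data scale n d A0 M \<pi> \<theta>1 \<theta>2 \<sigma>"
  proof
    show "\<sigma> \<in> dend_cochains scale A0 M (n + 1)"
      unfolding eqs using A multi by (intro degree_0_component_multilinear) auto
  qed (use n d A binary in \<open>simp_all add: eqs\<close>)
  interpret two_term_data scale n d A0 M \<pi> \<theta>1 \<theta>2 \<sigma>
    by (rule data)
  have zero: "A i = {0}" if "i \<noteq> 0" "i \<noteq> d" for i
    using two that by (simp add: two_term_def)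
  show AV: "A = V"
    by (rule ext) (simp add: zero two_term_space_def eqs(1,2))
  let ?H = "Poly_Mapping.single 0 ` A 0 \<union> Poly_Mapping.single d ` A d"
  have agree_H: "\<mu> k r xs = two_term_ops d n A0 M \<pi> \<theta>1 \<theta>2 \<sigma> k r xs"
    if k: "k \<ge> 1" and r: "r \<in> {1..k}" and xs: "xs \<in> tuples k ?H" for k r xs
  proof -
    have "\<exists>ds. set ds \<subseteq> {0, d} \<and> homogeneous_tuple A ds xs"
      using xs unfolding tuples_def mem_Collect_eq
    proof (induction xs arbitrary: k)
      case Nil
      then show ?case by (intro exI[of _ "[]"]) (simp add: homogeneous_tuple_def)
    next
      case (Cons x xs)
      then obtain ds where ds: "set ds \<subseteq> {0, d}" "homogeneous_tuple A ds xs"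
        by auto
      obtain p where "p \<in> {0, d}" "x \<in> homogeneous A p"
        using Cons.prems by (auto simp: homogeneous_def)
      with ds show ?case
        by (intro exI[of _ "p # ds"]) (simp add: homogeneous_tuple_def)
    qed
    then obtain ds where ds: "set ds \<subseteq> {0, d}" and hom: "homogeneous_tuple A ds xs"
      by blast
    have len: "length xs = k" "length ds = k"
      using xs hom by (auto simp: tuples_def homogeneous_tuple_def list_all2_conv_all_nth)
    define e where "e = sum_list ds + int k - 2"
    have deg: "\<mu> k r xs \<in> homogeneous A e"
      "two_term_ops d n A0 M \<pi> \<theta>1 \<theta>2 \<sigma> k r xs \<in> homogeneous A e"
      using degree[OF k r len(1) hom] \<mu>_homogeneous[OF k r len(1)] hom by (auto simp: e_def AV)
    \<comment> \<open>Homogeneous elements of a degree that carries only \<open>0\<close> agree.\<close>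
    have vanish: ?thesis if "e \<noteq> 0" "e \<noteq> d"
      using deg zero[OF that] by (simp add: homogeneous_def)
    have d_pos: "d \<ge> 1" using n d by simp
    consider "k = 1" | "k = 2" | "k \<ge> 3" using k by linarith
    then show ?thesis
    proof cases
      case 1
      then obtain x where x: "xs = [x]" using len(1) by (auto simp: length_Suc_conv)
      have "x \<in> direct_sum A"
        using homogeneous_tuple_mem[of ds xs] hom by (simp add: x tuples_def flip: AV)
      moreover have "r = 1" using r 1 by simp
      ultimately show ?thesis
        using two two_term_\<mu> unfolding 1 x two_term_def AV by simp
    next
      case 2
      obtain x y where xy: "xs = [x, y]" using len(1) 2 by (auto simp: numeral_2_eq_2 length_Suc_conv)
      obtain p q where pq: "ds = [p, q]" using len(2) 2 by (auto simp: numeral_2_eq_2 length_Suc_conv)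
      obtain a b where ab: "x = Poly_Mapping.single p a" "a \<in> A p" "y = Poly_Mapping.single q b" "b \<in> A q"
        using hom by (auto simp: xy pq homogeneous_tuple_def homogeneous_def)
      have r2: "r \<in> {1, 2}" using r 2 by auto
      have e: "e = p + q" using 2 by (simp add: e_def pq)
      have xyV: "x \<in> direct_sum V" "y \<in> direct_sum V"
        using homogeneous_tuple_mem[of ds xs] hom by (simp_all add: xy tuples_def AV)
      have eqI: ?thesis if "Poly_Mapping.lookup (\<mu> k r xs) e =
          Poly_Mapping.lookup (two_term_ops d n A0 M \<pi> \<theta>1 \<theta>2 \<sigma> k r xs) e"
        using deg that by (auto simp: homogeneous_def)
      consider "p = 0" "q = 0" | "p = 0" "q = d" | "p = d" "q = 0" | "p = d" "q = d"
        using ds by (auto simp: pq)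
      then show ?thesis
      proof cases
        case 1
        then have "Poly_Mapping.lookup (\<mu> 2 r [x, y]) 0 = \<pi> r a b"
          using ab r2 by (simp add: eqs(3) binary_component_def)
        then show ?thesis
          using 1 by (intro eqI) (simp add: e \<open>k = 2\<close> xy \<mu>_2_lookup[OF r2 xyV[unfolded ab(1,3) 1]] ab(1,3))
      next
        case 2
        have mem: "a \<in> A0" "b \<in> M" using ab 2 by (simp_all add: eqs(1,2))
        have "Poly_Mapping.lookup (\<mu> 2 r [x, y]) d = \<theta>1 r a b"
          using ab r2 2 by (simp add: eqs(4) binary_component_def)
        then show ?thesis
          using 2 by (intro eqI) (simp add: e \<open>k = 2\<close> xy \<mu>_2_lookup[OF r2 xyV[unfolded ab(1,3) 2]] ab(1,3) lookup_single
              mem ops_bilinear[OF r2])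
      next
        case 3
        have mem: "a \<in> M" "b \<in> A0" using ab 3 by (simp_all add: eqs(1,2))
        have "Poly_Mapping.lookup (\<mu> 2 r [x, y]) d = \<theta>2 r a b"
          using ab r2 3 by (simp add: eqs(5) binary_component_def)
        then show ?thesis
          using 3 by (intro eqI) (simp add: e \<open>k = 2\<close> xy \<mu>_2_lookup[OF r2 xyV[unfolded ab(1,3) 3]] ab(1,3) lookup_single
              mem ops_bilinear[OF r2])
      next
        case 4
        then show ?thesis using d_pos by (intro vanish) (auto simp: e)
      qed
    next
      case 3
      show ?thesis
      proof (cases "set ds \<subseteq> {0}")
        case True
        then have ds0: "ds = replicate k 0"
          using len(2) by (metis replicate_eqI singletonD subsetD)
        then have e: "e = int k - 2" by (simp add: e_def sum_list_replicate)
        show ?thesis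
        proof (cases "k = n + 1")
          case True
          have xs0: "x \<in> Poly_Mapping.single 0 ` A 0" if "x \<in> set xs" for x
            using hom that len unfolding ds0
            by (auto simp: homogeneous_tuple_def list_all2_conv_all_nth homogeneous_def in_set_conv_nth)
          define as where "as = map lo xs"
          have xs_as: "xs = map (Poly_Mapping.single 0) as"
            unfolding as_def map_map comp_def
            by (rule map_idI[symmetric]) (use xs0 in fastforce)
          have as: "as \<in> tuples (n + 1) (A 0)"
            using xs0 len True by (fastforce simp: as_def tuples_def)
          have xsV: "xs \<in> tuples (n + 1) (direct_sum V)"
            using homogeneous_tuple_mem[of ds xs] hom len True by (simp add: AV)
          have e: "e = d" using e d True by simp
          have "Poly_Mapping.lookup (\<mu> k r xs) d = \<sigma> r as"
            using r as True unfolding eqs(6) by (simp add: xs_as)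
          moreover have "two_term_ops d n A0 M \<pi> \<theta>1 \<theta>2 \<sigma> k r xs = Poly_Mapping.single d (\<sigma> r as)"
            using \<mu>_Suc_n[OF _ xsV] r True by (simp add: as_def)
          ultimately show ?thesis
            using deg(1) unfolding e by (auto simp: homogeneous_def)
        next
          case False
          then show ?thesis using 3 d by (intro vanish) (auto simp: e)
        qed
      next
        case False
        then have "d \<in> set ds" using ds by auto
        moreover have "0 \<le> x" if "x \<in> set ds" for x
          using ds d_pos that by auto
        ultimately have "d \<le> sum_list ds"
          by (rule member_le_sum_list_nonneg)
        then show ?thesis
          using 3 d_pos by (intro vanish) (auto simp: e_def)
      qed
    qed
  qed
  have H_sub: "?H \<subseteq> direct_sum A"
    using single_mem_direct_sum[where A = A, OF A] by auto
  have H_gen: "\<exists>y\<in>?H. \<exists>z\<in>?H. x = y + z" if "x \<in> direct_sum A" for x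
  proof -
    have "x = Poly_Mapping.single 0 (lo x) + Poly_Mapping.single d (hi x)"
      using that unfolding AV direct_sum_V
      by (intro poly_mapping_eqI) (simp add: lookup_add lookup_single when_def)
    moreover have "lo x \<in> A 0" "hi x \<in> A d"
      using that by (auto simp: direct_sum_def)
    ultimately show "\<exists>y\<in>?H. \<exists>z\<in>?H. x = y + z" by blast
  qed
  show "\<mu> = two_term_ops d n A0 M \<pi> \<theta>1 \<theta>2 \<sigma>"
  proof (rule PiE_ext[OF \<mu> \<mu>_PiE[folded AV]])
    fix k :: nat assume "k \<in> {1..}"
    then have k: "k \<ge> 1" by simp
    show "\<mu> k = two_term_ops d n A0 M \<pi> \<theta>1 \<theta>2 \<sigma> k"
    proof (rule PiE_ext)
      show "\<mu> k \<in> (\<Pi>\<^sub>E r\<in>{1..k}.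
          multilinear_maps (scale_sum scale) (scale_sum scale) k (direct_sum A) (direct_sum A))"
        using \<mu> \<open>k \<in> {1..}\<close> by (rule PiE_mem)
      show "two_term_ops d n A0 M \<pi> \<theta>1 \<theta>2 \<sigma> k \<in> (\<Pi>\<^sub>E r\<in>{1..k}.
          multilinear_maps (scale_sum scale) (scale_sum scale) k (direct_sum A) (direct_sum A))"
        using \<mu>_PiE[folded AV] \<open>k \<in> {1..}\<close> by (rule PiE_mem)
      fix r assume r: "r \<in> {1..k}"
      note m = multi[OF k r] \<mu>_multilinear[OF k r, folded AV]
      show "\<mu> k r = two_term_ops d n A0 M \<pi> \<theta>1 \<theta>2 \<sigma> k r"
      proof (rule PiE_ext)
        show "\<mu> k r \<in> tuples k (direct_sum A) \<rightarrow>\<^sub>E direct_sum A"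
          "two_term_ops d n A0 M \<pi> \<theta>1 \<theta>2 \<sigma> k r \<in> tuples k (direct_sum A) \<rightarrow>\<^sub>E direct_sum A"
          using m by (simp_all add: multilinear_maps_def)
        show "\<mu> k r xs = two_term_ops d n A0 M \<pi> \<theta>1 \<theta>2 \<sigma> k r xs"
          if "xs \<in> tuples k (direct_sum A)" for xs
          using m H_sub H_gen agree_H[OF k r] that by (rule multilinear_maps_eq)
      qed
    qed
  qed
qed

end

section \<open>The correspondence\<close>

theorem theorem6p3:
  fixes scale :: "'k::field_char_0 \<Rightarrow> 'v::ab_group_add \<Rightarrow> 'v"
    and n :: nat
  assumes "vector_space scale"
    and "n \<ge> 2"
  shows "bij_betw (dend_inf_to_cocycle n)
    {(A, \<mu>). dend_inf_algebra scale A \<mu> \<and> two_term (int n - 1) A \<mu>}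
    {((A, \<pi>), M, \<theta>1, \<theta>2, \<sigma>).
       dendriform_algebra scale A \<pi> \<and>
       dend_representation scale A \<pi> M \<theta>1 \<theta>2 \<and>
       dend_cocycle scale A \<pi> M \<theta>1 \<theta>2 (n + 1) \<sigma>}"
    (is "bij_betw _ ?S ?T")
proof -
  interpret vector_space scale by (rule assms(1))
  define rebuild where "rebuild = (\<lambda>((A :: 'v set, \<pi>), M, \<theta>1, \<theta>2, \<sigma>).
    (two_term_space (int n - 1) A M, two_term_ops (int n - 1) n A M \<pi> \<theta>1 \<theta>2 \<sigma>))"
  have forward: "dend_inf_to_cocycle n X \<in> ?T" "rebuild (dend_inf_to_cocycle n X) = X"
    if X_mem: "X \<in> ?S" for X
  proof -
    obtain A \<mu> where X: "X = (A, \<mu>)" by (cases X)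
    obtain A0 \<pi> M \<theta>1 \<theta>2 \<sigma> where comp: "dend_inf_to_cocycle n (A, \<mu>) = ((A0, \<pi>), M, \<theta>1, \<theta>2, \<sigma>)"
      by (cases "dend_inf_to_cocycle n (A, \<mu>)") auto
    have alg: "dend_inf_algebra scale A \<mu>" and two: "two_term (int n - 1) A \<mu>"
      using X_mem by (simp_all add: X)
    note alg_parts = alg[unfolded dend_inf_algebra_def]
    note parts = two_term_components[OF assms(2) refl
        alg_parts[THEN conjunct1, rule_format] alg_parts[THEN conjunct2, THEN conjunct1]
        alg_parts[THEN conjunct2, THEN conjunct2, THEN conjunct1, rule_format, OF _ _ conjI] two comp]
    have "dendriform_algebra scale A0 \<pi> \<and> dend_representation scale A0 \<pi> M \<theta>1 \<theta>2 \<and>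
        dend_cocycle scale A0 \<pi> M \<theta>1 \<theta>2 (n + 1) \<sigma>"
      using alg two_term_data.dend_inf_algebra_iff[OF parts(1)] by (simp only: parts(2,3)[symmetric])
    then show "dend_inf_to_cocycle n X \<in> ?T"
      by (simp only: X comp mem_Collect_eq prod.case)
    show "rebuild (dend_inf_to_cocycle n X) = X"
      by (simp only: X comp rebuild_def prod.case parts(2,3)[symmetric])
  qed
  have inverse: "rebuild Y \<in> ?S" "dend_inf_to_cocycle n (rebuild Y) = Y" if Y_mem: "Y \<in> ?T" for Y
  proof -
    obtain A \<pi> M \<theta>1 \<theta>2 \<sigma> where Y: "Y = ((A, \<pi>), M, \<theta>1, \<theta>2, \<sigma>)"
      by (cases Y) auto
    have T: "dendriform_algebra scale A \<pi>" "dend_representation scale A \<pi> M \<theta>1 \<theta>2"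
      "dend_cocycle scale A \<pi> M \<theta>1 \<theta>2 (n + 1) \<sigma>"
      using Y_mem by (simp_all add: Y)
    interpret two_term_data scale n "int n - 1" A M \<pi> \<theta>1 \<theta>2 \<sigma>
      using T assms(2)
      by unfold_locales (simp_all only: dendriform_algebra_def dend_representation_def dend_cocycle_def)
    show "rebuild Y \<in> ?S"
      using dend_inf_algebra_iff T two_term_\<mu> by (simp add: Y rebuild_def)
    show "dend_inf_to_cocycle n (rebuild Y) = Y"
      using dend_inf_to_cocycle_\<mu> by (simp add: Y rebuild_def)
  qed
  show ?thesis
  proof (rule bij_betw_byWitness)
    show "\<forall>X\<in>?S. rebuild (dend_inf_to_cocycle n X) = X"
      by (rule ballI) (rule forward(2))
    show "\<forall>Y\<in>?T. dend_inf_to_cocycle n (rebuild Y) = Y"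
      by (rule ballI) (rule inverse(2))
    show "dend_inf_to_cocycle n ` ?S \<subseteq> ?T"
      by (rule image_subsetI) (rule forward(1))
    show "rebuild ` ?T \<subseteq> ?S"
      by (rule image_subsetI) (rule inverse(1))
  qed
qed

end
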